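(* Let $\mathbb{B}^2=\{z\in\mathbb{C}^2:|z|<1\}$ and, for $r\in(0,1)$, let $\Omega_r=\{z\in\mathbb{C}^2:r<|z|<1\}$. For sufficiently small $r>0$ one has $$F_B^{\Omega_r}(z_0,N)<F_B^{\mathbb{B}^2}(z_0,N),\qquad N=\frac{z_0}{|z_0|},$$ for all $z_0\in\Omega_r$ close to the inner boundary of $\Omega_r$. That is, there exists $r_0\in(0,1)$ such that for every $r\in(0,r_0)$ there exists $\eta>0$ such that the inequality holds for every $z_0\in\Omega_r$ with $r<|z_0|<r+\eta$.
   Context: $|z|$ denotes the Euclidean norm on $\mathbb{C}^2$; the inner boundary of $\Omega_r$ is $\{|z|=r\}$. For a bounded domain $D\subset\mathbb{C}^n$, $K_D$ denotes the Bergman kernel of $D$ (the reproducing kernel of the space $L^2_h(D)$ of square-integrable holomorphic functions on $D$). The Bergman metric of $D$ at $p\in D$ in direction $\xi\in\mathbb{C}^n$ is $$F_B^{D}(p,\xi)=\left(\sum_{\nu,\mu=1}^{n}\frac{\partial^2\log K_D(z,z)}{\partial z_\nu\,\partial\overline{z_\mu}}\Big|_{z=p}\,\xi_\nu\overline{\xi_\mu}\right)^{1/2}.$$ *)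

theory Defs
  imports "HOL-Analysis.Analysis"
begin

text \<open>Holomorphy in several variables, for an open set \<open>D\<close>: complex differentiability, i.e.
  Frechet differentiability with a complex-linear derivative (a \<open>has_derivative\<close>-derivative is
  only real-linear by itself).\<close>

definition holomorphic_sv :: "(complex ^ 'n \<Rightarrow> complex) \<Rightarrow> (complex ^ 'n) set \<Rightarrow> bool" where
  "holomorphic_sv f D \<longleftrightarrow>
     (\<forall>z\<in>D. \<exists>f'. (f has_derivative f') (at z) \<and> (\<forall>c v. f' (c *s v) = c * f' v))"

text \<open>Functions are total here; only their values on \<open>D\<close> matter for membership.\<close>

definition L2h :: "(complex ^ 'n) set \<Rightarrow> (complex ^ 'n \<Rightarrow> complex) set" where
  "L2h D = {f. holomorphic_sv f D \<and> set_integrable lborel D (\<lambda>z. (cmod (f z))\<^sup>2)}"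

definition reproducing_kernel ::
    "(complex ^ 'n) set \<Rightarrow> (complex ^ 'n \<Rightarrow> complex ^ 'n \<Rightarrow> complex) \<Rightarrow> bool" where
  "reproducing_kernel D K \<longleftrightarrow>
     (\<forall>w\<in>D. (\<lambda>z. K z w) \<in> L2h D \<and>
            (\<forall>f\<in>L2h D. f w = (LINT z:D|lborel. f z * cnj (K z w))))"

text \<open>A reproducing kernel is determined on \<open>D \<times> D\<close>, so the choice operator in the definition of
  the Bergman kernel below only leaves the irrelevant values outside \<open>D \<times> D\<close> open.\<close>

lemma reproducing_kernel_unique:
  assumes K: "reproducing_kernel D K" and L: "reproducing_kernel D L"
    and z: "z \<in> D" and w: "w \<in> D"
  shows "K z w = L z w"
proof -
  have herm: "A x y = cnj (B y x)"
    if A: "reproducing_kernel D A" and B: "reproducing_kernel D B" and x: "x \<in> D" and y: "y \<in> D"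
    for A B x y
  proof -
    have mem: "(\<lambda>t. A t y) \<in> L2h D" "(\<lambda>t. B t x) \<in> L2h D"
      using A B x y unfolding reproducing_kernel_def by simp_all
    have repA: "f y = (LINT t:D|lborel. f t * cnj (A t y))" if "f \<in> L2h D" for f
      using A y that unfolding reproducing_kernel_def by simp
    have repB: "f x = (LINT t:D|lborel. f t * cnj (B t x))" if "f \<in> L2h D" for f
      using B x that unfolding reproducing_kernel_def by simp
    have "A x y = (LINT t:D|lborel. A t y * cnj (B t x))"
      by (rule repB[OF mem(1)])
    also have "\<dots> = cnj (LINT t:D|lborel. B t x * cnj (A t y))"
      unfolding set_lebesgue_integral_def
      by (subst Bochner_Integration.integral_cnj[symmetric]) (simp add: mult.commute del: Bochner_Integration.integral_cnj)
    also have "(LINT t:D|lborel. B t x * cnj (A t y)) = B y x"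
      by (rule repA[OF mem(2), symmetric])
    finally show ?thesis .
  qed
  show ?thesis
    using herm[OF K L z w] herm[OF L L z w] by simp
qed

definition bergman_kernel ::
    "(complex ^ 'n) set \<Rightarrow> complex ^ 'n \<Rightarrow> complex ^ 'n \<Rightarrow> complex" where
  "bergman_kernel D = (SOME K. reproducing_kernel D K)"

text \<open>Partial derivative of \<open>g\<close> at \<open>p\<close> in the real direction \<open>v\<close>, and the Wirtinger derivatives
  \<open>\<partial>/\<partial>z\<^sub>\<nu> = (\<partial>/\<partial>x\<^sub>\<nu> - \<i> \<partial>/\<partial>y\<^sub>\<nu>)/2\<close>, \<open>\<partial>/\<partial>z\<^sub>\<nu>\<close>-bar \<open>= (\<partial>/\<partial>x\<^sub>\<nu> + \<i> \<partial>/\<partial>y\<^sub>\<nu>)/2\<close>, where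
  \<open>z\<^sub>\<nu> = x\<^sub>\<nu> + \<i> y\<^sub>\<nu>\<close>.\<close>

definition dir_deriv ::
    "complex ^ 'n \<Rightarrow> (complex ^ 'n \<Rightarrow> complex) \<Rightarrow> complex ^ 'n \<Rightarrow> complex" where
  "dir_deriv v g p = vector_derivative (\<lambda>t::real. g (p + t *\<^sub>R v)) (at 0)"

definition wirtinger ::
    "'n \<Rightarrow> (complex ^ 'n \<Rightarrow> complex) \<Rightarrow> complex ^ 'n \<Rightarrow> complex" where
  "wirtinger \<nu> g p = (dir_deriv (axis \<nu> 1) g p - \<i> * dir_deriv (axis \<nu> \<i>) g p) / 2"

definition wirtinger_bar ::
    "'n \<Rightarrow> (complex ^ 'n \<Rightarrow> complex) \<Rightarrow> complex ^ 'n \<Rightarrow> complex" where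
  "wirtinger_bar \<nu> g p = (dir_deriv (axis \<nu> 1) g p + \<i> * dir_deriv (axis \<nu> \<i>) g p) / 2"

text \<open>\<open>K\<^sub>D(z,z)\<close> is real, and so is the Hermitian form under the square root; \<open>Re\<close> only
  changes the type.\<close>

definition bergman_metric :: "(complex ^ 'n) set \<Rightarrow> complex ^ 'n \<Rightarrow> complex ^ 'n \<Rightarrow> real" where
  "bergman_metric D p \<xi> =
     sqrt (Re (\<Sum>\<nu>\<in>UNIV. \<Sum>\<mu>\<in>UNIV.
       wirtinger \<nu> (wirtinger_bar \<mu> (\<lambda>z. of_real (ln (Re (bergman_kernel D z z))))) p
         * \<xi> $ \<nu> * cnj (\<xi> $ \<mu>)))"

definition shell :: "real \<Rightarrow> (complex ^ 2) set" where
  "shell r = {z. r < norm z \<and> norm z < 1}"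

end

theory Submission
  imports Defs "HOL-Complex_Analysis.Complex_Analysis"
begin

text \<open>By Hartogs, the monomials form an orthogonal basis of the square-integrable holomorphic functions
  on \<open>\<Omega>\<^sub>r\<close> as well as on the ball, and passing from the ball to \<open>\<Omega>\<^sub>r\<close> multiplies the squared norm of
  those of degree \<open>k\<close> by \<open>1 - q\<^bsup>k+2\<^esup>\<close>, where \<open>q = r\<^sup>2\<close>. Hence
  \<open>K(z,w) = \<pi>\<^bsup>-2\<^esup> \<Sum>\<^sub>k (k+1)(k+2) \<langle>z,w\<rangle>\<^sup>k / (1 - q\<^bsup>k+2\<^esup>)\<close>. On the diagonal this is a function \<open>\<Phi>(t)\<close> of
  \<open>t = \<bar>z\<bar>\<^sup>2\<close>, and the squared Bergman metric in the radial direction is \<open>(t (log \<Phi>)')'\<close>.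
  Writing \<open>\<Phi>\<close> as \<open>1 + v\<close> times the function \<open>2 \<pi>\<^bsup>-2\<^esup> (1-t)\<^bsup>-3\<^esup>\<close> belonging to the ball, the difference of
  the two squared metrics is \<open>(t v')' / (1+v) - t (v' / (1+v))\<^sup>2\<close>, and \<open>(t v')' < 0\<close> because for small
  \<open>q\<close> and \<open>t\<close> the constant term of the power series of \<open>v (1-t)\<^bsup>-3\<^esup>\<close> dominates.\<close>

text \<open>An \<open>f\<close> in \<open>L2h (shell r)\<close> comes without a power series, and
  none in two variables is ever produced. Unitary invariance moves \<open>w\<close> to the first
  coordinate axis, where the kernel depends on \<open>z $ 1\<close> alone. Then only the moments of
  \<open>f\<close> against powers of \<open>z $ 1\<close> matter, and averaging \<open>f\<close>
  over rotations of \<open>z $ 2\<close> reduces these to one holomorphic function \<open>g\<close>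
  of \<open>z $ 1\<close>; Hartogs becomes the gluing of two formulas for \<open>g\<close> on
  overlapping domains. The sign has a simple source. The hole changes the coefficient of degree k by
  the order of q^(k+2), so to first order it adds a positive constant c to (1-t)^(-3). Then v is c
  (1-t)^3, and (t v')' at t = 0 is v'(0) = -3c. The remaining work is to bound the other
  coefficients by a fraction of the constant one.\<close>

no_notation fps_nth (infixl "$" 75)

section \<open>Radial metrics and the coefficient series\<close>

text \<open>The kernel is known only on \<open>D\<close>, so a directional derivative is computed
  from a closed form that agrees with it on an open set around the point.\<close>

lemma dir_deriv_eqI:
  fixes g h :: "complex ^ 'n \<Rightarrow> complex"
  assumes "open D" "p \<in> D" and eq: "\<And>z. z \<in> D \<Longrightarrow> g z = h z"
    and der: "((\<lambda>t::real. h (p + t *\<^sub>R v)) has_vector_derivative d) (at 0)"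
  shows "dir_deriv v g p = d"
proof -
  let ?S = "(\<lambda>t::real. p + t *\<^sub>R v) -` D"
  have "open ?S"
    by (intro open_vimage assms continuous_intros)
  moreover have "0 \<in> ?S" using assms by simp
  ultimately have "((\<lambda>t::real. g (p + t *\<^sub>R v)) has_vector_derivative d) (at 0)"
    by (rule has_vector_derivative_transform_within_open[OF der]) (use eq in auto)
  then show ?thesis unfolding dir_deriv_def by (rule vector_derivative_at)
qed

lemma has_real_derivative_norm_power2_line:
  fixes z v :: "'a::real_inner"
  assumes "(u has_real_derivative d) (at ((norm z)\<^sup>2))"
  shows "((\<lambda>t. u ((norm (z + t *\<^sub>R v))\<^sup>2)) has_real_derivative d * (2 * (z \<bullet> v))) (at 0)"
proof -
  have "((\<lambda>t. (norm z)\<^sup>2 + 2 * t * (z \<bullet> v) + t\<^sup>2 * (norm v)\<^sup>2) has_real_derivative 2 * (z \<bullet> v)) (at 0)"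
    by (auto intro!: derivative_eq_intros)
  moreover have "(norm (z + t *\<^sub>R v))\<^sup>2 = (norm z)\<^sup>2 + 2 * t * (z \<bullet> v) + t\<^sup>2 * (norm v)\<^sup>2" for t
    unfolding power2_norm_eq_inner
    by (simp add: inner_simps inner_commute power2_eq_square algebra_simps)
  ultimately have "((\<lambda>t. (norm (z + t *\<^sub>R v))\<^sup>2) has_real_derivative 2 * (z \<bullet> v)) (at 0)"
    by simp
  moreover have "(u has_real_derivative d) (at ((norm (z + 0 *\<^sub>R v))\<^sup>2))"
    using assms by simp
  ultimately show ?thesis
    by (rule DERIV_chain2[rotated])
qed

text \<open>For a function of the squared norm the Levi form is \<open>u1\<close> times the identity
  plus \<open>u2\<close> times a rank-one form built from \<open>p\<close>; the unit vector along
  \<open>p\<close> is an eigenvector of both. \<open>u1\<close> is required on all of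
  \<open>D\<close> because it is differentiated again, \<open>u2\<close> only at
  \<open>p\<close>.\<close>

lemma bergman_metric_radial:
  fixes D :: "(complex ^ 'n) set" and u u1 :: "real \<Rightarrow> real"
  assumes D: "open D" "p \<in> D" "p \<noteq> 0"
    and u: "\<And>z. z \<in> D \<Longrightarrow> ln (Re (bergman_kernel D z z)) = u ((norm z)\<^sup>2)"
    and u1: "\<And>z. z \<in> D \<Longrightarrow> (u has_real_derivative u1 ((norm z)\<^sup>2)) (at ((norm z)\<^sup>2))"
    and u2: "(u1 has_real_derivative u2) (at ((norm p)\<^sup>2))"
  shows "bergman_metric D p (p /\<^sub>R norm p) = sqrt (u1 ((norm p)\<^sup>2) + (norm p)\<^sup>2 * u2)"
proof -
  let ?L = "\<lambda>z. complex_of_real (ln (Re (bergman_kernel D z z)))"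
  let ?t = "(norm p)\<^sup>2"
  have dL: "dir_deriv v ?L z = of_real (u1 ((norm z)\<^sup>2) * (2 * (z \<bullet> v)))" if "z \<in> D" for z v
  proof (rule dir_deriv_eqI[OF D(1) that])
    show "?L z = of_real (u ((norm z)\<^sup>2))" if "z \<in> D" for z
      using u[OF that] by simp
    show "((\<lambda>t. complex_of_real (u ((norm (z + t *\<^sub>R v))\<^sup>2))) has_vector_derivative
            of_real (u1 ((norm z)\<^sup>2) * (2 * (z \<bullet> v)))) (at 0)"
      using has_real_derivative_norm_power2_line[OF u1[OF that], of v]
      by (rule has_vector_derivative_of_real)
  qed
  \<comment> \<open>The real derivatives along \<open>axis \<mu> 1\<close> and
    \<open>axis \<mu> \<i>\<close> are twice \<open>u1\<close> times the real and imaginary part of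
    \<open>z $ \<mu>\<close>; the Wirtinger combination reassembles
    \<open>z $ \<mu>\<close>.\<close>
  have wb: "wirtinger_bar \<mu> ?L z = of_real (u1 ((norm z)\<^sup>2)) * z $ \<mu>" if "z \<in> D" for z \<mu>
    unfolding wirtinger_bar_def dL[OF that]
    by (simp add: inner_axis inner_complex_def complex_eq_iff)
  have d2: "dir_deriv v (wirtinger_bar \<mu> ?L) p =
      of_real (u2 * (2 * (p \<bullet> v))) * p $ \<mu> + of_real (u1 ?t) * v $ \<mu>" for v \<mu>
  proof (rule dir_deriv_eqI[OF D(1,2) wb], assumption)
    have "((\<lambda>t. u1 ((norm (p + t *\<^sub>R v))\<^sup>2)) has_real_derivative u2 * (2 * (p \<bullet> v))) (at 0)"
      by (rule has_real_derivative_norm_power2_line[OF u2])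
    then have 1: "((\<lambda>t. complex_of_real (u1 ((norm (p + t *\<^sub>R v))\<^sup>2))) has_vector_derivative
        of_real (u2 * (2 * (p \<bullet> v)))) (at 0)"
      by (rule has_vector_derivative_of_real)
    have 2: "((\<lambda>t. (p + t *\<^sub>R v) $ \<mu>) has_vector_derivative v $ \<mu>) (at 0)"
      by (auto intro!: derivative_eq_intros simp: has_vector_derivative_def)
    show "((\<lambda>t. complex_of_real (u1 ((norm (p + t *\<^sub>R v))\<^sup>2)) * (p + t *\<^sub>R v) $ \<mu>) has_vector_derivative
       of_real (u2 * (2 * (p \<bullet> v))) * p $ \<mu> + of_real (u1 ?t) * v $ \<mu>) (at 0)"
      using has_vector_derivative_mult[OF 1 2] by (simp add: add.commute)
  qed
  have w: "wirtinger \<nu> (wirtinger_bar \<mu> ?L) p =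
      of_real u2 * cnj (p $ \<nu>) * p $ \<mu> + (if \<nu> = \<mu> then of_real (u1 ?t) else 0)" for \<nu> \<mu>
  proof -
    have "axis \<nu> x $ \<mu> = (if \<nu> = \<mu> then x else 0)" for x :: complex
      by (simp add: axis_def)
    then show ?thesis
      unfolding wirtinger_def d2
      by (auto simp: inner_axis inner_complex_def complex_eq_iff field_simps)
  qed
  let ?n = "complex_of_real (norm p)"
  have pn: "(\<Sum>\<nu>\<in>UNIV. p $ \<nu> * cnj (p $ \<nu>)) = ?n\<^sup>2"
  proof -
    have "(norm p)\<^sup>2 = (\<Sum>\<nu>\<in>UNIV. (norm (p $ \<nu>))\<^sup>2)"
      by (simp add: norm_vec_def L2_set_def sum_nonneg)
    then have "?n\<^sup>2 = (\<Sum>\<nu>\<in>UNIV. (of_real (norm (p $ \<nu>)))\<^sup>2)"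
      by (metis (no_types, lifting) of_real_power of_real_sum sum.cong)
    then show ?thesis by (simp only: complex_norm_square[symmetric] of_real_power)

  qed
  have n0: "?n \<noteq> 0" using D by simp
  have comp: "(p /\<^sub>R norm p) $ \<nu> = p $ \<nu> / ?n" for \<nu>
    unfolding vector_scaleR_component by (simp add: scaleR_conv_of_real divide_inverse mult.commute)
  have "(\<Sum>\<nu>\<in>UNIV. \<Sum>\<mu>\<in>UNIV. wirtinger \<nu> (wirtinger_bar \<mu> ?L) p
         * (p /\<^sub>R norm p) $ \<nu> * cnj ((p /\<^sub>R norm p) $ \<mu>))
      = (\<Sum>\<nu>\<in>UNIV. \<Sum>\<mu>\<in>UNIV. of_real u2 * (p $ \<nu> * cnj (p $ \<nu>)) * (p $ \<mu> * cnj (p $ \<mu>)) / ?n\<^sup>2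
          + (if \<nu> = \<mu> then of_real (u1 ?t) * (p $ \<mu> * cnj (p $ \<mu>)) / ?n\<^sup>2 else 0))"
    unfolding w comp by (intro sum.cong refl) (auto simp: power2_eq_square field_simps n0 add_divide_distrib)
  also have "\<dots> = of_real u2 * (\<Sum>\<nu>\<in>UNIV. p $ \<nu> * cnj (p $ \<nu>)) * (\<Sum>\<nu>\<in>UNIV. p $ \<nu> * cnj (p $ \<nu>)) / ?n\<^sup>2
      + of_real (u1 ?t) * (\<Sum>\<nu>\<in>UNIV. p $ \<nu> * cnj (p $ \<nu>)) / ?n\<^sup>2"
    by (simp add: sum.distrib sum_distrib_left sum_distrib_right sum_divide_distrib mult_ac)
  also have "\<dots> = of_real (u1 ?t + ?t * u2)"
    unfolding pn using n0 by (simp add: power2_eq_square)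
  finally show ?thesis
    unfolding bergman_metric_def by simp
qed

section \<open>Coefficients of the kernel series and their deviation from the ball\<close>

definition shell_coeff :: "real \<Rightarrow> nat \<Rightarrow> real" where
  "shell_coeff q k = (real k + 1) * (real k + 2) / (1 - q ^ (k + 2))"

text \<open>The excess of \<open>shell_coeff q k\<close> over the ball coefficient (k+1)(k+2), by
  1/(1-x) = 1 + x/(1-x); it vanishes for \<open>q = 0\<close>. With \<open>q\<close> the squared
  inner radius, \<open>shell_coeff q k\<close> itself is pi^2 divided by the squared norm of the
  k-th power of the first coordinate.\<close>

definition shell_defect :: "real \<Rightarrow> nat \<Rightarrow> real" where
  "shell_defect q k = (real k + 1) * (real k + 2) * (q ^ (k + 2) / (1 - q ^ (k + 2)))"

lemma one_minus_power_ge: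
  fixes q :: real
  assumes "0 \<le> q" "q < 1"
  shows "1 - q\<^sup>2 \<le> 1 - q ^ (k + 2)" "0 < 1 - q\<^sup>2" "0 < 1 - q ^ (k + 2)"
proof -
  show 1: "1 - q\<^sup>2 \<le> 1 - q ^ (k + 2)"
    using assms power_decreasing[of 2 "k + 2" q] by simp
  show 2: "0 < 1 - q\<^sup>2"
    using assms by (simp add: power_less_one_iff)
  show "0 < 1 - q ^ (k + 2)"
    using 1 2 by linarith
qed

lemma shell_coeff_eq:
  assumes "0 \<le> q" "q < 1"
  shows "shell_coeff q k = (real k + 1) * (real k + 2) + shell_defect q k"
proof -
  have "1 - q ^ (k + 2) \<noteq> 0"
    using one_minus_power_ge(3)[OF assms, of k] by linarith
  then have "1 / (1 - q ^ (k + 2)) = 1 + q ^ (k + 2) / (1 - q ^ (k + 2))"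
    by (simp add: field_simps del: power_Suc add_2_eq_Suc')
  then show ?thesis
    unfolding shell_coeff_def shell_defect_def by (metis distrib_left mult.right_neutral times_divide_eq_right)
qed

lemma shell_coeff_pos:
  assumes "0 \<le> q" "q < 1"
  shows "0 < shell_coeff q k"
  unfolding shell_coeff_def using one_minus_power_ge(3)[OF assms, of k] by (intro divide_pos_pos) auto

text \<open>One more termwise derivative of the series of 1/(1-z)^2. At x = |z|^2 it is pi^2 times
  the diagonal kernel of the ball.\<close>

lemma sums_Suc_Suc_power:
  fixes x :: "'a::{real_normed_field,banach}"
  assumes "norm x < 1"
  shows "(\<lambda>k. of_nat ((k + 1) * (k + 2)) * x ^ k) sums (2 / (1 - x) ^ 3)"
proof -
  have sm: "summable (\<lambda>k. of_nat (k + 1) * z ^ k)" and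
       eq: "(\<Sum>k. of_nat (k + 1) * z ^ k) = 1 / (1 - z)\<^sup>2" if "norm z < 1" for z :: 'a
    using geometric_deriv_sums[OF that] by (simp_all add: sums_iff)
  have der: "((\<lambda>z. \<Sum>k. of_nat (k + 1) * z ^ k) has_field_derivative
      (\<Sum>k. diffs (\<lambda>k. of_nat (k + 1)) k * x ^ k)) (at x)"
    by (rule termdiffs_strong'[where K = 1]) (use sm assms in auto)
  have "((\<lambda>z. 1 / (1 - z)\<^sup>2) has_field_derivative 2 / (1 - x) ^ 3) (at x)"
    using assms by (auto intro!: derivative_eq_intros simp: divide_simps power_numeral_reduce)
  moreover have "((\<lambda>z. \<Sum>k. of_nat (k + 1) * z ^ k) has_field_derivative d) (at x) \<longleftrightarrow>
      ((\<lambda>z. 1 / (1 - z)\<^sup>2) has_field_derivative d) (at x)" for d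
    by (rule has_field_derivative_cong_eventually)
      (use eventually_nhds_in_open[OF open_ball, of x 0 1] assms eq in
        \<open>auto elim!: eventually_mono simp: eventually_at_filter\<close>)
  ultimately have "(\<Sum>k. diffs (\<lambda>k. of_nat (k + 1)) k * x ^ k) = 2 / (1 - x) ^ 3"
    using der DERIV_unique by blast
  moreover have "summable (\<lambda>k. diffs (\<lambda>k. of_nat (k + 1)) k * x ^ k)"
    by (rule termdiff_converges[of x 1]) (use sm assms in auto)
  ultimately show ?thesis
    by (simp add: sums_iff diffs_def algebra_simps)
qed

lemma summable_shell_coeff:
  fixes x :: "'a::{real_normed_field,banach}"
  assumes "0 \<le> q" "q < 1" "norm x < 1"
  shows "summable (\<lambda>k. norm (of_real (shell_coeff q k) * x ^ k))"
proof (rule summable_comparison_test')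
  have "summable (\<lambda>k. real ((k + 1) * (k + 2)) * norm x ^ k)"
    using sums_Suc_Suc_power[of "norm x"] assms(3) by (simp add: sums_iff)
  then show "summable (\<lambda>k. 1 / (1 - q\<^sup>2) * (real ((k + 1) * (k + 2)) * norm x ^ k))"
    by (rule summable_mult)
  fix k
  have "shell_coeff q k \<le> (real k + 1) * (real k + 2) / (1 - q\<^sup>2)"
    unfolding shell_coeff_def using one_minus_power_ge[OF assms(1,2)]
    by (intro divide_left_mono mult_pos_pos) auto
  then have "shell_coeff q k * norm x ^ k \<le> (real k + 1) * (real k + 2) / (1 - q\<^sup>2) * norm x ^ k"
    by (rule mult_right_mono) simp
  then show "norm (norm (of_real (shell_coeff q k) * x ^ k))
      \<le> 1 / (1 - q\<^sup>2) * (real ((k + 1) * (k + 2)) * norm x ^ k)"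
    using shell_coeff_pos[OF assms(1,2), of k]
    by (simp add: norm_mult norm_power algebra_simps add_divide_distrib)
qed

text \<open>Passing from k to k + 1 multiplies the left side by (k+1)(k+3)/k^2, which decreases in k
  and equals 8 at k = 1; there both sides are 6. This is the origin of both constants.\<close>

lemma square_mult_le_power_eight:
  assumes "k \<ge> 1"
  shows "k\<^sup>2 * ((k + 1) * (k + 2)) \<le> 6 * 8 ^ (k - 1)"
  using assms
proof (induction k rule: dec_induct)
  case base
  then show ?case by simp
next
  case (step k)
  have "(k + 1) * (k + 3) \<le> 8 * k\<^sup>2"
  proof -
    have "k * 1 \<le> k * k" using step by (intro mult_left_mono) auto
    then have "3 + k * 4 \<le> 7 * (k * k)" using step(1) by linarith
    then show ?thesis by (simp add: power2_eq_square algebra_simps)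
  qed
  then have "(k + 1) * (k + 3) * ((k + 1) * (k + 2)) \<le> 8 * k\<^sup>2 * ((k + 1) * (k + 2))"
    by (rule mult_right_mono) simp
  also have "\<dots> \<le> 8 * (6 * 8 ^ (k - 1))"
    using step.IH by simp
  also have "\<dots> = 6 * 8 ^ k"
    using step(1) by (cases k) auto
  finally show ?case
    by (simp add: power2_eq_square algebra_simps)
qed

lemma shell_defect_nonneg:
  assumes "0 \<le> q" "q < 1"
  shows "0 \<le> shell_defect q k"
  unfolding shell_defect_def using one_minus_power_ge(3)[OF assms, of k] assms(1)
  by (intro mult_nonneg_nonneg divide_nonneg_nonneg) auto

lemma summable_shell_defect:
  assumes "0 \<le> q" "q < 1" "norm x < 1"
  shows "summable (\<lambda>k. shell_defect q k * x ^ k)"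
proof -
  have "summable (\<lambda>k. shell_coeff q k * x ^ k - of_nat ((k + 1) * (k + 2)) * x ^ k)"
    using summable_norm_cancel[OF summable_shell_coeff[OF assms]] sums_Suc_Suc_power[OF assms(3)]
    by (intro summable_diff) (auto simp: sums_iff)
  also have "(\<lambda>k. shell_coeff q k * x ^ k - of_nat ((k + 1) * (k + 2)) * x ^ k)
      = (\<lambda>k. shell_defect q k * x ^ k)"
    unfolding shell_coeff_eq[OF assms(1,2)] by (simp add: algebra_simps)
  finally show ?thesis .
qed

lemma shell_coeff_suminf:
  assumes "0 \<le> q" "q < 1" "norm x < 1"
  shows "(\<Sum>k. shell_coeff q k * x ^ k) = 2 / (1 - x) ^ 3 + (\<Sum>k. shell_defect q k * x ^ k)"
proof -
  have "(\<lambda>k. of_nat ((k + 1) * (k + 2)) * x ^ k + shell_defect q k * x ^ k)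
      sums (2 / (1 - x) ^ 3 + (\<Sum>k. shell_defect q k * x ^ k))"
    by (intro sums_add sums_Suc_Suc_power summable_sums summable_shell_defect assms)
  also have "(\<lambda>k. of_nat ((k + 1) * (k + 2)) * x ^ k + shell_defect q k * x ^ k)
      = (\<lambda>k. shell_coeff q k * x ^ k)"
    unfolding shell_coeff_eq[OF assms(1,2)] by (simp add: algebra_simps)
  finally show ?thesis by (simp add: sums_iff)
qed

text \<open>Since \<open>diffs\<close> yields (k+1) times the next coefficient, the left side is the
  k-th term of (t psi')', with psi the series of \<open>shell_defect q\<close>. The factor
  q^2/(1-q^2) is half the constant coefficient of psi, so the bound measures the other terms against
  that coefficient.\<close>

lemma diffs_square_bound:
  assumes q: "0 \<le> q" "q < 1" and t: "0 \<le> t"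
  shows "diffs (shell_defect q) k * t ^ k + real k * (diffs (shell_defect q) k * t ^ k)
    \<le> 6 * q * (q\<^sup>2 / (1 - q\<^sup>2)) * (8 * q * t) ^ k"
proof -
  let ?e = "q\<^sup>2 / (1 - q\<^sup>2)"
  have "q ^ (k + 3) / (1 - q ^ (k + 3)) \<le> q ^ (k + 3) / (1 - q\<^sup>2)"
    using one_minus_power_ge(1,3)[OF q, of "k + 1"] one_minus_power_ge(2)[OF q] q
    by (intro divide_left_mono mult_pos_pos) (auto simp: numeral_3_eq_3)
  also have "\<dots> = q ^ (k + 1) * ?e"
    by (simp add: power_add power2_eq_square power3_eq_cube)
  finally have e: "q ^ (k + 3) / (1 - q ^ (k + 3)) \<le> q ^ (k + 1) * ?e" .
  have "real ((k + 1)\<^sup>2 * ((k + 2) * (k + 3))) \<le> real (6 * 8 ^ k)"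
    using square_mult_le_power_eight[of "k + 1"] by (intro of_nat_mono) (simp add: numeral_3_eq_3)
  then have n: "(real k + 1)\<^sup>2 * ((real k + 2) * (real k + 3)) \<le> 6 * 8 ^ k"
    by (simp only: of_nat_mult of_nat_power of_nat_add of_nat_1 of_nat_numeral)
  have "diffs (shell_defect q) k * t ^ k + real k * (diffs (shell_defect q) k * t ^ k)
      = (real k + 1)\<^sup>2 * ((real k + 2) * (real k + 3)) * (q ^ (k + 3) / (1 - q ^ (k + 3))) * t ^ k"
    by (simp add: diffs_def shell_defect_def power2_eq_square numeral_3_eq_3 algebra_simps add_divide_distrib)
  also have "\<dots> \<le> (6 * 8 ^ k) * (q ^ (k + 1) * ?e) * t ^ k"
    using one_minus_power_ge(3)[OF q, of "k + 1"] q t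
    by (intro mult_right_mono mult_mono[OF n e]) (auto simp: numeral_3_eq_3)
  finally show ?thesis
    by (simp add: power_mult_distrib algebra_simps)
qed

text \<open>\<open>p0\<close>, \<open>p1\<close>, \<open>p2\<close> are the value and the first two derivatives of \<open>\<psi> = \<Sum>k. shell_defect q k * t ^ k\<close>;
  the left-hand side is \<open>(t v')' / (1 - t)\<close> for \<open>v = (1 - t)\<^sup>3 \<psi>\<close>.\<close>

lemma shell_defect_inequality:
  assumes q: "0 < q" "q < 1/16" and t: "0 < t" "t < 1/16"
  defines "p0 \<equiv> (\<Sum>k. shell_defect q k * t ^ k)"
    and "p1 \<equiv> (\<Sum>k. diffs (shell_defect q) k * t ^ k)"
    and "p2 \<equiv> (\<Sum>k. diffs (diffs (shell_defect q)) k * t ^ k)"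
  shows "(- 3 * (1 - t) + 6 * t) * p0 + ((1 - t)\<^sup>2 - 6 * t * (1 - t)) * p1 + t * (1 - t)\<^sup>2 * p2 < 0"
    and "p0 > 0"
proof -
  let ?d = "shell_defect q"
  define e where "e = q\<^sup>2 / (1 - q\<^sup>2)"
  have q1: "0 \<le> q" "q < 1" and tn: "norm t < 1" using q t by auto
  have s0: "summable (\<lambda>k. ?d k * x ^ k)" if "norm x < 1" for x
    using summable_shell_defect[OF q1 that] .
  have s1: "summable (\<lambda>k. diffs ?d k * x ^ k)" if "norm x < 1" for x
    by (rule termdiff_converges[of x 1]) (use s0 that in auto)
  have s2: "summable (\<lambda>k. diffs (diffs ?d) k * t ^ k)"
    by (rule termdiff_converges[of t 1]) (use s1 tn in auto)
  have nn: "0 \<le> ?d k" for k using shell_defect_nonneg[OF q1] .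
  have e0: "e > 0" unfolding e_def using q one_minus_power_ge(2)[OF q1] by simp
  have "2 * e = ?d 0 * t ^ 0" by (simp add: shell_defect_def e_def power2_eq_square)
  also have "\<dots> \<le> p0"
    unfolding p0_def using sum_le_suminf[OF s0[OF tn], of "{0}"] nn t by simp
  finally have p0: "2 * e \<le> p0" .
  then show "p0 > 0" using e0 by linarith
  have p1: "p1 \<ge> 0" unfolding p1_def
    using nn t by (intro suminf_nonneg s1 tn) (simp add: diffs_def)
  have p2: "p2 \<ge> 0" unfolding p2_def
    using nn t by (intro suminf_nonneg s2) (simp add: diffs_def)
  \<comment> \<open>Multiplying the series of psi'' by t shifts its index by one; the new term at k
    = 0 is zero because of the factor k.\<close>
  have shift: "(\<lambda>k. real k * (diffs ?d k * t ^ k)) sums (t * p2)"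
  proof -
    have "(\<lambda>k. t * (diffs (diffs ?d) k * t ^ k)) sums (t * p2)"
      unfolding p2_def by (intro sums_mult summable_sums s2)
    then have "(\<lambda>k. real (Suc k) * (diffs ?d (Suc k) * t ^ Suc k)) sums (t * p2)"
      by (simp add: diffs_def[of "diffs ?d"] mult_ac)
    then show ?thesis
      by (subst (asm) sums_Suc_iff) simp
  qed
  have qt: "q * t < 1/16 * (1/16)" using q t by (intro mult_strict_mono) auto
  have "(\<lambda>k. 6 * q * e * (8 * q * t) ^ k) sums (6 * q * e * (1 / (1 - 8 * q * t)))"
    using qt q t by (intro sums_mult geometric_sums) simp
  then have "p1 + t * p2 \<le> 6 * q * e * (1 / (1 - 8 * q * t))"
    unfolding p1_def using diffs_square_bound[OF q1 less_imp_le[OF t(1)], folded e_def]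
    by (intro sums_le[OF _ sums_add[OF summable_sums[OF s1[OF tn]] shift]])
  also have "\<dots> = e * (6 * q * (1 / (1 - 8 * q * t)))"
    by simp
  \<comment> \<open>Here 8 q t < 1/32, so 1/2 is a generous lower bound for the denominator;
    together with q < 1/16 the result is 3/4 of \<open>e\<close>.\<close>
  also have "\<dots> \<le> e * (6 * (1/16) * (1 / (1/2)))"
  proof (rule mult_left_mono)
    show "6 * q * (1 / (1 - 8 * q * t)) \<le> 6 * (1/16) * (1 / (1/2))"
      using qt q by (intro mult_mono divide_left_mono) auto
  qed (use e0 in simp)
  finally have "p1 + t * p2 \<le> e * (3/4)" by simp
  then have p12: "p1 + t * p2 \<le> e" using e0 by linarith
  \<comment> \<open>The coefficient is 9 t - 3, below -2 as soon as t < 1/9. As \<open>p0\<close> is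
    at least \<open>2 * e\<close>, this term is at most -4 \<open>e\<close> and outweighs the
    remainder, which is at most \<open>e\<close>.\<close>
  have "(- 3 * (1 - t) + 6 * t) * p0 \<le> - 2 * p0"
    using \<open>p0 > 0\<close> t by (intro mult_right_mono) auto
  moreover have "((1 - t)\<^sup>2 - 6 * t * (1 - t)) * p1 \<le> 1 * p1"
  proof (rule mult_right_mono[OF _ p1])
    have "(1 - t)\<^sup>2 \<le> 1" using t by (intro power_le_one) auto
    moreover have "0 \<le> 6 * t * (1 - t)" using t by simp
    ultimately show "(1 - t)\<^sup>2 - 6 * t * (1 - t) \<le> 1" by linarith
  qed
  moreover have "t * (1 - t)\<^sup>2 * p2 \<le> t * 1 * p2"
    using t p2 by (intro mult_right_mono mult_left_mono power_le_one) auto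
  ultimately show "(- 3 * (1 - t) + 6 * t) * p0 + ((1 - t)\<^sup>2 - 6 * t * (1 - t)) * p1
      + t * (1 - t)\<^sup>2 * p2 < 0"
    using p12 p0 e0 by linarith
qed

text \<open>The logarithm of \<open>P0\<close> is that of \<open>V0\<close> minus 3 log (1-t), and
  the second summand contributes exactly the right-hand side. \<open>V0\<close> is twice the 1 + v
  of the overview. \<open>p0\<close>, \<open>p1\<close>, \<open>p2\<close> are plain numbers here,
  so the calculus becomes field arithmetic.\<close>

lemma log_derivative_comparison:
  fixes t p0 p1 p2 :: real
  assumes t: "0 < t" "t < 1" and p0: "p0 \<ge> 0"
    and W: "(- 3 * (1 - t) + 6 * t) * p0 + ((1 - t)\<^sup>2 - 6 * t * (1 - t)) * p1 + t * (1 - t)\<^sup>2 * p2 < 0"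
  defines "P0 \<equiv> 2 / (1 - t) ^ 3 + p0" and "P1 \<equiv> 6 / (1 - t) ^ 4 + p1" and "P2 \<equiv> 24 / (1 - t) ^ 5 + p2"
  shows "P1 / P0 + t * ((P2 * P0 - P1 * P1) / (P0 * P0)) < 3 / (1 - t)\<^sup>2"
proof -
  define x where "x = 1 - t"
  have x: "x > 0" "t = 1 - x" using t by (auto simp: x_def)
  \<comment> \<open>\<open>V0 = (1 - t)\<^sup>3 P0\<close> with its first two derivatives\<close>
  define V0 where "V0 = 2 + x ^ 3 * p0"
  define V1 where "V1 = x ^ 3 * p1 - 3 * x\<^sup>2 * p0"
  define V2 where "V2 = x ^ 3 * p2 - 6 * x\<^sup>2 * p1 + 6 * x * p0"
  have V0: "V0 > 0" using p0 x unfolding V0_def by (simp add: add_pos_nonneg)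
  have "V1 + t * V2 = x * ((- 3 * x + 6 * t) * p0 + (x\<^sup>2 - 6 * t * x) * p1 + t * x\<^sup>2 * p2)"
    unfolding V1_def V2_def by (simp add: algebra_simps power2_eq_square power3_eq_cube)
  then have neg: "V1 + t * V2 < 0"
    using W x by (simp add: mult_pos_neg flip: x_def)
  have P: "P0 = V0 / x ^ 3" "P1 = (x * V1 + 3 * V0) / x ^ 4"
    "P2 = (x\<^sup>2 * V2 + 6 * x * V1 + 12 * V0) / x ^ 5"
    using x(1) unfolding P0_def P1_def P2_def V0_def V1_def V2_def
    by (simp_all add: field_simps power_numeral_reduce flip: x_def)
  define a b y where "a = V1 / V0" and "b = V2 / V0" and "y = 1 / x"
  have P10: "P1 / P0 = a + 3 * y"
    unfolding P a_def y_def using x(1) V0 by (simp add: field_simps power_numeral_reduce)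
  have P20: "P2 / P0 = b + 6 * a * y + 12 * y\<^sup>2"
    unfolding P a_def b_def y_def using x(1) V0 by (simp add: field_simps power_numeral_reduce)
  have "P0 \<noteq> 0" using V0 x(1) unfolding P by simp
  then have "(P2 * P0 - P1 * P1) / (P0 * P0) = P2 / P0 - (P1 / P0)\<^sup>2"
    by (simp add: field_simps power2_eq_square)
  also have "\<dots> = b - a\<^sup>2 + 3 * y\<^sup>2"
    unfolding P10 P20 by (simp add: power2_eq_square algebra_simps)
  finally have "P1 / P0 + t * ((P2 * P0 - P1 * P1) / (P0 * P0))
      = (a + t * b) - t * a\<^sup>2 + 3 * (y + t * y\<^sup>2)"
    unfolding P10 by (simp only: distrib_left right_diff_distrib mult_ac)
  \<comment> \<open>This is the derivative of t/(1-t), that is, the radial expression of - log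
    (1-t); three times it is the squared metric of the ball.\<close>
  also have "y + t * y\<^sup>2 = 1 / x\<^sup>2"
    using x(1) unfolding x(2) y_def by (simp add: field_simps power2_eq_square)
  finally have "P1 / P0 + t * ((P2 * P0 - P1 * P1) / (P0 * P0))
      = (a + t * b) - t * a\<^sup>2 + 3 / x\<^sup>2" by simp
  moreover have "a + t * b < 0"
    using neg V0 unfolding a_def b_def by (simp add: field_simps)
  moreover have "0 \<le> t * a\<^sup>2" using t by simp
  ultimately show ?thesis by (simp flip: x_def)
qed

section \<open>Measure-preserving maps and integrals over shells\<close>

text \<open>Source and target types may differ, so that the property composes across pairs,
  \<open>complex\<close> and \<open>complex ^ 2\<close>. Rotations and unitary maps are then
  assembled from shears and relabellings of the basis.\<close>

definition lborel_preserving :: "('a::euclidean_space \<Rightarrow> 'b::euclidean_space) \<Rightarrow> bool" where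
  "lborel_preserving f \<longleftrightarrow> f \<in> borel_measurable borel \<and> distr lborel borel f = lborel"

lemma lborel_preserving_comp:
  assumes "lborel_preserving f" "lborel_preserving g"
  shows "lborel_preserving (\<lambda>x. g (f x))"
proof -
  have [measurable]: "f \<in> borel_measurable borel" "g \<in> borel_measurable borel"
    using assms by (auto simp: lborel_preserving_def)
  have "distr lborel borel (\<lambda>x. g (f x)) = distr (distr lborel borel f) borel g"
    by (subst distr_distr) (auto simp: o_def)
  then show ?thesis
    using assms by (simp add: lborel_preserving_def)
qed

text \<open>For fixed \<open>y\<close> the map is a translation in \<open>x\<close>, and Fubini
  integrates this over \<open>y\<close>; so \<open>L\<close> may be any measurable map.\<close>

lemma lborel_preserving_shear:
  fixes L :: "'b::euclidean_space \<Rightarrow> 'a::euclidean_space"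
  assumes [measurable]: "L \<in> borel_measurable borel"
  shows "lborel_preserving (\<lambda>(x, y). (x + L y, y))" (is "lborel_preserving ?f")
  unfolding lborel_preserving_def
proof
  show fm [measurable]: "?f \<in> borel_measurable borel"
    by (simp add: borel_prod[symmetric])
  show "distr lborel borel ?f = lborel"
  proof (rule measure_eqI)
    fix A :: "('a \<times> 'b) set" assume "A \<in> sets (distr lborel borel ?f)"
    then have A [measurable]: "A \<in> sets borel" by simp
    have A': "A \<in> sets (lborel \<Otimes>\<^sub>M lborel)" "?f -` A \<in> sets (lborel \<Otimes>\<^sub>M lborel)"
      unfolding lborel_prod using measurable_sets_borel[OF fm A] A by auto
    have "emeasure (lborel \<Otimes>\<^sub>M lborel) (?f -` A)
        = (\<integral>\<^sup>+y. emeasure lborel ((\<lambda>x. (x, y)) -` (?f -` A)) \<partial>lborel)"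
      by (rule lborel_pair.emeasure_pair_measure_alt2[OF A'(2)])
    also have "\<dots> = (\<integral>\<^sup>+y. emeasure lborel ((\<lambda>x. (x, y)) -` A) \<partial>lborel)"
    proof (rule nn_integral_cong)
      fix y :: 'b
      have [measurable]: "(\<lambda>x. (x, y)) -` A \<in> sets borel"
        by (rule measurable_sets_borel[OF _ A])
          (intro borel_measurable_continuous_onI continuous_intros)
      have "emeasure lborel ((\<lambda>x. (x, y)) -` A)
          = emeasure (distr lborel borel ((+) (L y))) ((\<lambda>x. (x, y)) -` A)"
        by (simp only: lborel_distr_plus)
      also have "\<dots> = emeasure lborel ((\<lambda>x. (x, y)) -` (?f -` A))"
        by (subst emeasure_distr) (auto intro!: arg_cong[where f = "emeasure lborel"] simp: add.commute)
      finally show "emeasure lborel ((\<lambda>x. (x, y)) -` (?f -` A)) = emeasure lborel ((\<lambda>x. (x, y)) -` A)" ..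
    qed
    also have "\<dots> = emeasure (lborel \<Otimes>\<^sub>M lborel) A"
      by (rule lborel_pair.emeasure_pair_measure_alt2[OF A'(1), symmetric])
    finally show "emeasure (distr lborel borel ?f) A = emeasure lborel A"
      by (simp add: emeasure_distr lborel_prod)
  qed simp
qed

text \<open>Basis vectors go to basis vectors, so the preimage of a box is a box with the same side
  lengths. Meant for relabellings of coordinates, not for general isometries.\<close>

lemma lborel_preserving_isometry:
  fixes T :: "'a::euclidean_space \<Rightarrow> 'b::euclidean_space"
  assumes "linear T" and inner: "\<And>x y. T x \<bullet> T y = x \<bullet> y" and basis: "T ` Basis = Basis"
  shows "lborel_preserving T"
  unfolding lborel_preserving_def
proof
  show Tm: "T \<in> borel_measurable borel"
    by (rule borel_measurable_continuous_onI[OF linear_continuous_on[OF linear_conv_bounded_linear[THEN iffD1, OF assms(1)]]])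
  have inj: "inj T"
  proof (rule injI)
    fix x y assume "T x = T y"
    then have "(x - y) \<bullet> (x - y) = 0"
      by (metis inner inner_diff_left linear_diff[OF assms(1)] cancel_comm_monoid_add_class.diff_cancel inner_zero_left)
    then show "x = y" by simp
  qed
  have surj: "surj T"
  proof -
    have "span (range T) = UNIV"
      by (metis basis span_Basis span_mono image_mono subset_UNIV top.extremum_uniqueI)
    then show ?thesis
      by (metis assms(1) linear_subspace_image subspace_UNIV span_eq_iff)
  qed
  have ball: "(\<forall>b\<in>Basis. P b) \<longleftrightarrow> (\<forall>b\<in>Basis. P (T b))" for P
    by (subst basis[symmetric]) simp
  show "distr lborel borel T = lborel"
  proof (rule lborel_eqI[symmetric])
    fix l u :: 'b assume lu: "\<And>b. b \<in> Basis \<Longrightarrow> l \<bullet> b \<le> u \<bullet> b"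
    obtain l' u' where l': "l = T l'" and u': "u = T u'" using surj by (meson surjD)
    have "T -` box l u = box l' u'"
      unfolding l' u' box_def ball by (auto simp: inner)
    moreover have "emeasure lborel (box l' u') = (\<Prod>b\<in>Basis. (u' - l') \<bullet> b)"
      by (rule emeasure_lborel_box) (metis basis imageI inner l' lu u')
    moreover have "(\<Prod>b\<in>Basis. (u - l) \<bullet> b) = (\<Prod>b\<in>Basis. (u' - l') \<bullet> b)"
    proof -
      have "(\<Prod>b\<in>Basis. (u - l) \<bullet> b) = (\<Prod>b\<in>T ` Basis. (u - l) \<bullet> b)"
        by (simp only: basis)
      also have "\<dots> = (\<Prod>b\<in>Basis. (u - l) \<bullet> T b)"
        by (rule prod.reindex[OF inj_on_subset[OF inj], unfolded o_def]) simp
      finally show ?thesis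
        unfolding l' u' by (simp add: inner inner_diff_left)
    qed
    ultimately show "emeasure (distr lborel borel T) (box l u) = (\<Prod>b\<in>Basis. (u - l) \<bullet> b)"
      using Tm by (simp add: emeasure_distr)
  qed simp
qed

lemma lborel_preserving_swap:
  "lborel_preserving (prod.swap :: 'b::euclidean_space \<times> 'a::euclidean_space \<Rightarrow> 'a \<times> 'b)"
proof (rule lborel_preserving_isometry)
  show "linear (prod.swap :: 'b \<times> 'a \<Rightarrow> 'a \<times> 'b)"
    by (rule linearI) auto
  show "prod.swap ` (Basis :: ('b \<times> 'a) set) = (Basis :: ('a \<times> 'b) set)"
    unfolding Basis_prod_def by force
qed (auto simp: inner_prod_def)

text \<open>Such a matrix is a product of an upper, a lower and an upper triangular shear.\<close>

lemma lborel_preserving_SL2: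
  fixes a b c d :: "'a::{real_normed_field,euclidean_space}"
  assumes det: "a * d - b * c = 1" and c: "c \<noteq> 0"
  shows "lborel_preserving (\<lambda>(x, y). (a * x + b * y, c * x + d * y))"
proof -
  \<comment> \<open>One argument serves two uses: \<open>'a\<close> is \<open>real\<close> for
    rotations of a complex coordinate and \<open>complex\<close> for unitary maps. The middle shear
    supplies the lower left entry \<open>c\<close>, the outer two then correct the diagonal to
    \<open>a\<close> and \<open>d\<close>, and the determinant fixes \<open>b\<close>.\<close>
  define S where "S e = (\<lambda>(x, y). (x + e * y, y))" for e :: 'a
  have S: "lborel_preserving (S e)" for e
    unfolding S_def by (rule lborel_preserving_shear) simp
  have S': "lborel_preserving (\<lambda>z. prod.swap (S e (prod.swap z)))" for e
    by (rule lborel_preserving_comp[OF lborel_preserving_comp[OF lborel_preserving_swap S] lborel_preserving_swap])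
  have "lborel_preserving (\<lambda>z. S ((a - 1) / c) (prod.swap (S c (prod.swap (S ((d - 1) / c) z)))))"
    by (rule lborel_preserving_comp[OF lborel_preserving_comp[OF S S'] S])
  also have "(\<lambda>z. S ((a - 1) / c) (prod.swap (S c (prod.swap (S ((d - 1) / c) z)))))
      = (\<lambda>(x, y). (a * x + b * y, c * x + d * y))"
  proof (rule ext, clarify)
    fix x y :: 'a
    have b: "b = (a * d - 1) / c" using det c by (simp add: field_simps)
    show "S ((a - 1) / c) (prod.swap (S c (prod.swap (S ((d - 1) / c) (x, y)))))
        = (a * x + b * y, c * x + d * y)"
      unfolding b S_def using c by (simp add: field_simps)
  qed
  finally show ?thesis .
qed

lemma lborel_preserving_Complex: "lborel_preserving (\<lambda>(x, y). Complex x y)"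
proof (rule lborel_preserving_isometry)
  show "linear (\<lambda>(x, y). Complex x y)"
    by (rule linearI) (auto simp: complex_eq_iff)
  show "(\<lambda>(x, y). Complex x y) ` Basis = Basis"
    unfolding Basis_prod_def Basis_complex_def by (auto simp: complex_eq_iff image_iff)
qed (auto simp: inner_prod_def inner_complex_def)

text \<open>As a real matrix the rotation has determinant 1 and lower left entry Im \<alpha>. Only
  \<alpha> = 1 and \<alpha> = -1 escape the factorization into shears; they are products of
  \<open>\<i>\<close> and \<open>- \<i> * \<alpha>\<close>, neither of which is real.\<close>

lemma lborel_preserving_complex_rotation:
  fixes \<alpha> :: complex
  assumes "cmod \<alpha> = 1"
  shows "lborel_preserving ((*) \<alpha>)"
proof -
  have *: "lborel_preserving ((*) \<alpha>)" if "cmod \<alpha> = 1" "Im \<alpha> \<noteq> 0" for \<alpha>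
  proof -
    let ?C = "\<lambda>(x, y). Complex x y"
    let ?R = "\<lambda>(x, y). (Re \<alpha> * x + (- Im \<alpha>) * y, Im \<alpha> * x + Re \<alpha> * y)"
    have m: "(*) \<alpha> \<in> borel_measurable borel" by simp
    have "(Re \<alpha>)\<^sup>2 + (Im \<alpha>)\<^sup>2 = 1" using that(1) by (simp add: cmod_def)
    then have R: "lborel_preserving ?R"
      using that(2) by (intro lborel_preserving_SL2) (auto simp: power2_eq_square)
    have C: "?C \<in> borel_measurable borel" "distr lborel borel ?C = lborel"
      using lborel_preserving_Complex by (auto simp: lborel_preserving_def)
    have "distr lborel borel ((*) \<alpha>) = distr (distr lborel borel ?C) borel ((*) \<alpha>)"
      by (simp only: C)
    also have "\<dots> = distr lborel borel (\<lambda>z. \<alpha> * ?C z)"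
      using C(1) by (subst distr_distr) (auto simp: o_def)
    also have "(\<lambda>z. \<alpha> * ?C z) = (\<lambda>z. ?C (?R z))"
      by (auto simp: complex_eq_iff)
    also have "distr lborel borel (\<lambda>z. ?C (?R z)) = lborel"
      using lborel_preserving_comp[OF R lborel_preserving_Complex] by (simp add: lborel_preserving_def)
    finally show ?thesis using m by (simp add: lborel_preserving_def)
  qed
  show ?thesis
  proof (cases "Im \<alpha> = 0")
    case False
    then show ?thesis using * assms by blast
  next
    case True
    then have "Re \<alpha> \<noteq> 0" using assms by (auto simp: cmod_def)
    then have "lborel_preserving ((*) (- \<i> * \<alpha>))" "lborel_preserving ((*) \<i>)"
      using assms by (auto intro!: * simp: norm_mult)
    then have "lborel_preserving (\<lambda>z. \<i> * ((- \<i> * \<alpha>) * z))"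
      by (rule lborel_preserving_comp)
    then show ?thesis by (simp add: mult.assoc[symmetric])
  qed
qed

section \<open>Coordinates and rotations of C^2\<close>

definition vec2 :: "complex \<times> complex \<Rightarrow> complex ^ 2" where
  "vec2 p = (\<chi> i. if i = 1 then fst p else snd p)"

lemma vec2_nth [simp]: "vec2 p $ 1 = fst p" "vec2 p $ 2 = snd p"
  by (simp_all add: vec2_def)

lemma vec2_eta [simp]: "vec2 (z $ 1, z $ 2) = z"
  by (simp add: vec2_def vec_eq_iff forall_2)

lemma lborel_preserving_vec2: "lborel_preserving vec2"
proof (rule lborel_preserving_isometry)
  show "linear vec2"
    by (rule linearI) (simp_all add: vec_eq_iff forall_2)
  show "vec2 x \<bullet> vec2 y = x \<bullet> y" for x y
    by (simp add: inner_vec_def sum_2 inner_prod_def)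
  have "vec2 (u, 0) = axis 1 u" "vec2 (0, u) = axis 2 u" for u
    by (simp_all add: vec_eq_iff forall_2 axis_def)
  then show "vec2 ` Basis = Basis"
    unfolding Basis_prod_def Basis_vec_def by (simp add: image_Un image_image UNIV_2 SUP_insert) blast
qed

lemma lborel_preserving_of_vec2:
  assumes "lborel_preserving (\<lambda>p. R (vec2 p))" "R \<in> borel_measurable borel"
  shows "lborel_preserving R"
proof -
  have v: "vec2 \<in> borel_measurable borel" "distr lborel borel vec2 = lborel"
    using lborel_preserving_vec2 by (auto simp: lborel_preserving_def)
  have "distr lborel borel R = distr (distr lborel borel vec2) borel R"
    by (simp only: v)
  also have "\<dots> = distr lborel borel (\<lambda>p. R (vec2 p))"
    using v(1) assms(2) by (subst distr_distr) (auto simp: o_def)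
  finally show ?thesis
    using assms by (auto simp: lborel_preserving_def)
qed

lemma lborel_preserving_map_prod:
  assumes "lborel_preserving f" "lborel_preserving g"
  shows "lborel_preserving (\<lambda>(x, y). (f x, g y))"
proof -
  have [measurable]: "f \<in> borel_measurable borel" "g \<in> borel_measurable borel"
    and d: "distr lborel borel f = lborel" "distr lborel borel g = lborel"
    using assms by (auto simp: lborel_preserving_def)
  have "distr lborel borel f \<Otimes>\<^sub>M distr lborel borel g
      = distr (lborel \<Otimes>\<^sub>M lborel) (borel \<Otimes>\<^sub>M borel) (\<lambda>(x, y). (f x, g y))"
    by (rule pair_measure_distr) (auto simp: d intro: sigma_finite_lborel)
  then show ?thesis
    unfolding lborel_preserving_def by (simp add: d lborel_prod borel_prod) (simp add: borel_prod[symmetric])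
qed

lemma lborel_preserving_id: "lborel_preserving (\<lambda>x. x)"
  by (simp add: lborel_preserving_def distr_id2)

lemma lborel_preserving_vec2_rotation:
  assumes "cmod \<alpha> = 1"
  shows "lborel_preserving (\<lambda>z :: complex ^ 2. vec2 (\<alpha> * z $ 1, z $ 2))"
    and "lborel_preserving (\<lambda>z :: complex ^ 2. vec2 (z $ 1, \<alpha> * z $ 2))"
proof -
  note r = lborel_preserving_complex_rotation[OF assms]
  note c = lborel_preserving_comp[OF lborel_preserving_map_prod lborel_preserving_vec2]
  have m: "(\<lambda>z :: complex ^ 2. vec2 (a * z $ 1, b * z $ 2)) \<in> borel_measurable borel" for a b
  proof (intro borel_measurable_continuous_onI, unfold vec2_def, rule continuous_on_vec_lambda)
    show "continuous_on UNIV (\<lambda>z :: complex ^ 2. if i = 1 then fst (a * z $ 1, b * z $ 2)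
        else snd (a * z $ 1, b * z $ 2))" for i :: 2
      by (cases "i = 1") (auto intro!: continuous_intros)
  qed
  show "lborel_preserving (\<lambda>z :: complex ^ 2. vec2 (\<alpha> * z $ 1, z $ 2))"
    using c[OF r lborel_preserving_id] m[of \<alpha> 1]
    by (intro lborel_preserving_of_vec2) (auto simp: case_prod_beta')
  show "lborel_preserving (\<lambda>z :: complex ^ 2. vec2 (z $ 1, \<alpha> * z $ 2))"
    using c[OF lborel_preserving_id r] m[of 1 \<alpha>]
    by (intro lborel_preserving_of_vec2) (auto simp: case_prod_beta')
qed

text \<open>Each \<open>R t\<close> preserves the integral, so by Fubini the average over t does
  too; \<open>Rm\<close> supplies the joint measurability. Integrability of the average is stated as
  well because two averagings are later carried out in succession.\<close>

lemma integral_rotation_average: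
  fixes H :: "'a::euclidean_space \<Rightarrow> complex" and R :: "real \<Rightarrow> 'a \<Rightarrow> 'a"
  assumes H: "integrable lborel H"
    and R: "\<And>t. lborel_preserving (R t)"
    and Rm: "(\<lambda>(t, z). R t z) \<in> borel_measurable borel"
  shows "integrable lborel (\<lambda>z. LINT t:{0..1}|lborel. H (R t z))"
    and "(LINT z|lborel. (LINT t:{0..1}|lborel. H (R t z))) = (LINT z|lborel. H z)"
proof -
  have Hm: "H \<in> borel_measurable borel" using H by simp
  have HR: "integrable lborel (\<lambda>z. H (R t z))" "(LINT z|lborel. H (R t z)) = (LINT z|lborel. H z)"
    "(LINT z|lborel. norm (H (R t z))) = (LINT z|lborel. norm (H z))" for t
  proof -
    have [measurable]: "R t \<in> borel_measurable lborel" and d: "distr lborel borel (R t) = lborel"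
      using R[of t] by (auto simp: lborel_preserving_def)
    show "integrable lborel (\<lambda>z. H (R t z))"
      using H by (subst integrable_distr_eq[symmetric, where N = borel]) (use Hm in \<open>auto simp: d\<close>)
    show "(LINT z|lborel. H (R t z)) = (LINT z|lborel. H z)"
      using Hm by (subst integral_distr[symmetric, where N = borel]) (auto simp: d)
    show "(LINT z|lborel. norm (H (R t z))) = (LINT z|lborel. norm (H z))"
      using Hm by (subst integral_distr[symmetric, where N = borel and f = "\<lambda>z. norm (H z)"]) (auto simp: d)
  qed
  let ?F = "\<lambda>t z. indicator {0..1::real} t *\<^sub>R H (R t z)"
  have [measurable]: "(\<lambda>p. H (case p of (t, z) \<Rightarrow> R t z)) \<in> borel_measurable (lborel \<Otimes>\<^sub>M lborel)"
    using measurable_compose[OF Rm Hm] by (simp add: lborel_prod)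
  have F: "integrable (lborel \<Otimes>\<^sub>M lborel) (\<lambda>(t, z). ?F t z)"
  proof (rule lborel_pair.Fubini_integrable)
    have "(\<lambda>p. indicator {0..1} (fst p) *\<^sub>R H (case p of (t, z) \<Rightarrow> R t z))
        \<in> borel_measurable (lborel \<Otimes>\<^sub>M lborel)"
      by measurable
    then show "(\<lambda>(t, z). ?F t z) \<in> borel_measurable (lborel \<Otimes>\<^sub>M lborel)"
      by (simp add: case_prod_beta')
    show "integrable lborel (\<lambda>t. LINT z|lborel. norm (case (t, z) of (t, z) \<Rightarrow> ?F t z))"
      by (simp add: HR(3))
    show "AE t in lborel. integrable lborel (\<lambda>z. case (t, z) of (t, z) \<Rightarrow> ?F t z)"
      by (simp add: HR(1))
  qed
  show "integrable lborel (\<lambda>z. LINT t:{0..1}|lborel. H (R t z))"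
    unfolding set_lebesgue_integral_def by (rule lborel_pair.integrable_snd[OF F])
  have "(LINT z|lborel. (LINT t:{0..1}|lborel. H (R t z))) = (LINT t|lborel. (LINT z|lborel. ?F t z))"
    unfolding set_lebesgue_integral_def by (rule lborel_pair.Fubini_integral[OF F])
  also have "\<dots> = (LINT z|lborel. H z)"
    by (simp add: HR(2))
  finally show "(LINT z|lborel. (LINT t:{0..1}|lborel. H (R t z))) = (LINT z|lborel. H z)" .
qed

text \<open>A disc of squared radius a has area pi * a, so in the variable |z|^2 the density is
  constant. It suffices to compare the half-lines \<open>{..a}\<close>.\<close>

lemma distr_norm_power2_complex:
  "distr lborel borel (\<lambda>z :: complex. (norm z)\<^sup>2) = density lborel (\<lambda>x. ennreal pi * indicator {0..} x)"
    (is "?M = ?N")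
proof (rule measure_eqI_generator_eq[where E = "range (\<lambda>a::real. {..a})" and \<Omega> = UNIV and A = "\<lambda>i. {..real i}"])
  have eq: "emeasure ?M {..a} = (if a < 0 then 0 else ennreal (pi * a))"
    "emeasure ?N {..a} = (if a < 0 then 0 else ennreal (pi * a))" for a
  proof -
    have "(\<lambda>z::complex. (norm z)\<^sup>2) -` {..a} = (if a < 0 then {} else cball 0 (sqrt a))"
    proof (cases "a < 0")
      case True
      then have "\<not> (norm z)\<^sup>2 \<le> a" for z :: complex
        using zero_le_power2[of "norm z"] by linarith
      then show ?thesis using True by auto
    next
      case False
      have "(norm z)\<^sup>2 \<le> a \<longleftrightarrow> norm z \<le> sqrt a" for z :: complex
        using real_sqrt_le_iff[of "(norm z)\<^sup>2" a] by simp
      then show ?thesis using False by auto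
    qed
    then show "emeasure ?M {..a} = (if a < 0 then 0 else ennreal (pi * a))"
      by (simp add: emeasure_distr emeasure_cball unit_ball_vol_2)
    have "emeasure ?N {..a} = (\<integral>\<^sup>+x. ennreal pi * indicator {0..a} x \<partial>lborel)"
      by (subst emeasure_density) (auto intro!: nn_integral_cong simp: indicator_def)
    also have "\<dots> = ennreal pi * emeasure lborel {0..a}"
      by (rule nn_integral_cmult_indicator) simp
    finally show "emeasure ?N {..a} = (if a < 0 then 0 else ennreal (pi * a))"
      by (auto simp: ennreal_mult')
  qed
  show "emeasure ?M X = emeasure ?N X" if "X \<in> range (\<lambda>a::real. {..a})" for X
    using that eq by auto
  show "emeasure ?M {..real i} \<noteq> \<infinity>" for i
    unfolding eq by simp
  show "(\<Union>i. {..real i}) = UNIV"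
    by (auto intro: real_arch_simple)
  show "Int_stable (range (\<lambda>a::real. {..a}))"
    by (auto simp: Int_stable_def)
qed (auto simp: borel_eq_atMost)

lemma nn_integral_norm_power2_complex:
  assumes [measurable]: "f \<in> borel_measurable borel"
  shows "(\<integral>\<^sup>+(z::complex). f ((norm z)\<^sup>2) \<partial>lborel) = (\<integral>\<^sup>+x. ennreal pi * indicator {0..} x * f x \<partial>lborel)"
proof -
  have "(\<integral>\<^sup>+(z::complex). f ((norm z)\<^sup>2) \<partial>lborel) = (\<integral>\<^sup>+x. f x \<partial>(distr lborel borel (\<lambda>z :: complex. (norm z)\<^sup>2)))"
    by (subst nn_integral_distr) auto
  also have "\<dots> = (\<integral>\<^sup>+x. ennreal pi * indicator {0..} x * f x \<partial>lborel)"
    unfolding distr_norm_power2_complex by (subst nn_integral_density) auto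
  finally show ?thesis .
qed

lemma norm_vec2: "norm (vec2 p) = sqrt ((cmod (fst p))\<^sup>2 + (cmod (snd p))\<^sup>2)"
  by (simp add: norm_vec_def L2_set_def sum_2)

text \<open>The fibre of \<open>B\<close> over \<open>z $ 1\<close> is a disc of area \<open>\<pi> (\<rho>\<^sup>2 - \<bar>z $ 1\<bar>\<^sup>2)\<close>.\<close>

lemma nn_integral_monomial_ball:
  assumes \<rho>: "0 \<le> \<rho>" and B: "B = ball 0 \<rho> \<or> B = cball (0 :: complex ^ 2) \<rho>"
  shows "(\<integral>\<^sup>+z\<in>B. ennreal (cmod (z $ 1) ^ (2 * k)) \<partial>lborel)
    = ennreal (pi\<^sup>2 * \<rho> ^ (2 * k + 4) / ((real k + 1) * (real k + 2)))"
proof -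
  have v: "vec2 \<in> borel_measurable borel" "distr lborel borel vec2 = lborel"
    using lborel_preserving_vec2 by (auto simp: lborel_preserving_def)
  have [measurable]: "B \<in> sets borel" using B by auto
  have f: "(\<lambda>z :: complex ^ 2. ennreal (cmod (z $ 1) ^ (2 * k))) \<in> borel_measurable borel"
    by (intro measurable_compose[OF _ measurable_ennreal] borel_measurable_continuous_onI continuous_intros)
  have fB [measurable]: "(\<lambda>z. ennreal (cmod (z $ 1) ^ (2 * k)) * indicator B z) \<in> borel_measurable borel"
    by (intro borel_measurable_times_ennreal f borel_measurable_indicator) simp
  have fB' [measurable]: "(\<lambda>p. ennreal (cmod (fst p) ^ (2 * k)) * indicator B (vec2 p)) \<in> borel_measurable borel"
    using measurable_compose[OF v(1) fB] by simp
  have "(\<integral>\<^sup>+z\<in>B. ennreal (cmod (z $ 1) ^ (2 * k)) \<partial>lborel)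
      = (\<integral>\<^sup>+z\<in>B. ennreal (cmod (z $ 1) ^ (2 * k)) \<partial>(distr lborel borel vec2))"
    by (simp only: v)
  also have "\<dots> = (\<integral>\<^sup>+p. ennreal (cmod (fst p) ^ (2 * k)) * indicator B (vec2 p) \<partial>lborel)"
    using v(1) fB by (subst nn_integral_distr) auto
  also have "\<dots> = (\<integral>\<^sup>+p. ennreal (cmod (fst p) ^ (2 * k)) * indicator B (vec2 p) \<partial>(lborel \<Otimes>\<^sub>M lborel))"
    by (simp only: lborel_prod)
  also have "\<dots> = (\<integral>\<^sup>+a. (\<integral>\<^sup>+b. ennreal (cmod a ^ (2 * k)) * indicator B (vec2 (a, b)) \<partial>lborel) \<partial>lborel)"
    using fB' by (subst lborel.nn_integral_fst[symmetric]) (auto simp: lborel_prod)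
  also have "\<dots> = (\<integral>\<^sup>+(a::complex). ennreal (((cmod a)\<^sup>2) ^ k) *
      (indicator {..\<rho>\<^sup>2} ((cmod a)\<^sup>2) * ennreal (pi * (\<rho>\<^sup>2 - (cmod a)\<^sup>2))) \<partial>lborel)"
  proof (rule nn_integral_cong)
    fix a :: complex
    let ?s = "sqrt (\<rho>\<^sup>2 - (cmod a)\<^sup>2)"
    have fib: "(\<integral>\<^sup>+b. indicator B (vec2 (a, b)) \<partial>lborel)
        = indicator {..\<rho>\<^sup>2} ((cmod a)\<^sup>2) * ennreal (pi * (\<rho>\<^sup>2 - (cmod a)\<^sup>2))"
    proof (cases "(cmod a)\<^sup>2 \<le> \<rho>\<^sup>2")
      case True
      have lt: "sqrt ((cmod a)\<^sup>2 + (cmod b)\<^sup>2) < \<rho> \<longleftrightarrow> cmod b < ?s"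
        and le: "sqrt ((cmod a)\<^sup>2 + (cmod b)\<^sup>2) \<le> \<rho> \<longleftrightarrow> cmod b \<le> ?s" for b
      proof -
        have "sqrt ((cmod a)\<^sup>2 + (cmod b)\<^sup>2) < sqrt (\<rho>\<^sup>2) \<longleftrightarrow> sqrt ((cmod b)\<^sup>2) < ?s"
          unfolding real_sqrt_less_iff by auto
        then show "sqrt ((cmod a)\<^sup>2 + (cmod b)\<^sup>2) < \<rho> \<longleftrightarrow> cmod b < ?s" using \<rho> by simp
        have "sqrt ((cmod a)\<^sup>2 + (cmod b)\<^sup>2) \<le> sqrt (\<rho>\<^sup>2) \<longleftrightarrow> sqrt ((cmod b)\<^sup>2) \<le> ?s"
          unfolding real_sqrt_le_iff by auto
        then show "sqrt ((cmod a)\<^sup>2 + (cmod b)\<^sup>2) \<le> \<rho> \<longleftrightarrow> cmod b \<le> ?s" using \<rho> by simp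
      qed
      \<comment> \<open>Open and closed balls are treated together because a shell is the open unit
        ball minus a closed ball; no null sphere has to be discarded.\<close>
      obtain B' where B': "B' = ball 0 ?s \<or> B' = cball 0 ?s" and "\<And>b. vec2 (a, b) \<in> B \<longleftrightarrow> b \<in> B'"
        using B
      proof
        assume "B = ball 0 \<rho>"
        then show ?thesis by (intro that[of "ball 0 ?s"]) (auto simp: norm_vec2 lt)
      next
        assume "B = cball 0 \<rho>"
        then show ?thesis by (intro that[of "cball 0 ?s"]) (auto simp: norm_vec2 le)
      qed
      then have "(\<integral>\<^sup>+b. indicator B (vec2 (a, b)) \<partial>lborel) = (\<integral>\<^sup>+b. indicator B' b \<partial>lborel)"
        by (intro nn_integral_cong) (auto simp: indicator_def)
      also have "\<dots> = emeasure lborel B'"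
        using B' by (intro nn_integral_indicator) auto
      also have "\<dots> = ennreal (pi * (\<rho>\<^sup>2 - (cmod a)\<^sup>2))"
        using B' True by (auto simp: emeasure_ball emeasure_cball unit_ball_vol_2)
      finally show ?thesis using True by simp
    next
      case False
      then have "\<rho> < cmod a" using \<rho> by (meson not_less power_mono norm_ge_zero)
      moreover have "cmod a \<le> sqrt ((cmod a)\<^sup>2 + (cmod b)\<^sup>2)" for b
        by (rule real_le_rsqrt) simp
      ultimately have gt: "\<rho> < sqrt ((cmod a)\<^sup>2 + (cmod b)\<^sup>2)" for b
        by (rule less_le_trans)
      have "vec2 (a, b) \<notin> B" for b
        using B gt[of b] by (auto simp: norm_vec2 not_less not_le less_imp_le)
      then show ?thesis using False by simp
    qed
    show "(\<integral>\<^sup>+b. ennreal (cmod a ^ (2 * k)) * indicator B (vec2 (a, b)) \<partial>lborel)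
       = ennreal (((cmod a)\<^sup>2) ^ k) * (indicator {..\<rho>\<^sup>2} ((cmod a)\<^sup>2) * ennreal (pi * (\<rho>\<^sup>2 - (cmod a)\<^sup>2)))"
    proof (subst nn_integral_cmult)
      have "(\<lambda>b. vec2 (a, b)) \<in> borel_measurable borel"
        by (rule measurable_compose[OF _ v(1)])
          (intro borel_measurable_continuous_onI continuous_intros)
      then show "(\<lambda>b. indicator B (vec2 (a, b)) :: ennreal) \<in> borel_measurable lborel"
        by simp
    qed (simp add: fib power_mult)
  qed
  \<comment> \<open>With x = |a|^2 there remains pi^2 times the integral of x^k (\<rho>^2 - x) from
    0 to \<rho>^2.\<close>
  also have "\<dots> = (\<integral>\<^sup>+x. ennreal pi * indicator {0..} x *
      (ennreal (x ^ k) * (indicator {..\<rho>\<^sup>2} x * ennreal (pi * (\<rho>\<^sup>2 - x)))) \<partial>lborel)"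
    by (rule nn_integral_norm_power2_complex) measurable
  also have "\<dots> = (\<integral>\<^sup>+x. ennreal (pi\<^sup>2 * (\<rho>\<^sup>2 * x ^ k - x ^ Suc k)) * indicator {0..\<rho>\<^sup>2} x \<partial>lborel)"
    by (intro nn_integral_cong)
      (auto simp: indicator_def ennreal_mult'[symmetric] ennreal_mult''[symmetric] power2_eq_square algebra_simps)
  also have "\<dots> = ennreal (pi\<^sup>2 * (\<rho>\<^sup>2 * (\<rho>\<^sup>2) ^ Suc k / (real k + 1) - (\<rho>\<^sup>2) ^ Suc (Suc k) / (real k + 2))
      - pi\<^sup>2 * (\<rho>\<^sup>2 * 0 ^ Suc k / (real k + 1) - 0 ^ Suc (Suc k) / (real k + 2)))"
  proof (rule nn_integral_FTC_Icc[where F = "\<lambda>x. pi\<^sup>2 * (\<rho>\<^sup>2 * x ^ Suc k / (real k + 1) - x ^ Suc (Suc k) / (real k + 2))"])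
    fix x :: real assume x: "x \<in> {0..\<rho>\<^sup>2}"
    have "((\<lambda>x. x ^ Suc k / (real k + 1)) has_real_derivative x ^ k) (at x)"
      by (rule DERIV_cong[OF DERIV_cdivide[OF DERIV_pow]]) (simp add: field_simps)
    moreover have "((\<lambda>x. x ^ Suc (Suc k) / (real k + 2)) has_real_derivative x ^ Suc k) (at x)"
      by (rule DERIV_cong[OF DERIV_cdivide[OF DERIV_pow]]) (simp add: field_simps)
    ultimately have "((\<lambda>x. pi\<^sup>2 * (\<rho>\<^sup>2 * (x ^ Suc k / (real k + 1)) - x ^ Suc (Suc k) / (real k + 2)))
        has_real_derivative pi\<^sup>2 * (\<rho>\<^sup>2 * x ^ k - x ^ Suc k)) (at x)"
      by (intro DERIV_cmult DERIV_diff)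
    then show "((\<lambda>x. pi\<^sup>2 * (\<rho>\<^sup>2 * x ^ Suc k / (real k + 1) - x ^ Suc (Suc k) / (real k + 2)))
        has_real_derivative pi\<^sup>2 * (\<rho>\<^sup>2 * x ^ k - x ^ Suc k)) (at x)" by simp
    show "0 \<le> pi\<^sup>2 * (\<rho>\<^sup>2 * x ^ k - x ^ Suc k)"
      using x mult_right_mono[of x "\<rho>\<^sup>2" "x ^ k"] by simp
  qed auto
  also have "pi\<^sup>2 * (\<rho>\<^sup>2 * (\<rho>\<^sup>2) ^ Suc k / (real k + 1) - (\<rho>\<^sup>2) ^ Suc (Suc k) / (real k + 2))
      - pi\<^sup>2 * (\<rho>\<^sup>2 * 0 ^ Suc k / (real k + 1) - 0 ^ Suc (Suc k) / (real k + 2))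
      = pi\<^sup>2 * ((\<rho>\<^sup>2) ^ Suc (Suc k) * (1 / (real k + 1) - 1 / (real k + 2)))"
    by (simp add: algebra_simps)
  also have "1 / (real k + 1) - 1 / (real k + 2) = 1 / ((real k + 1) * (real k + 2))"
    by (simp add: field_simps)
  also have "(\<rho>\<^sup>2) ^ Suc (Suc k) = \<rho> ^ (2 * k + 4)"
    unfolding power_mult[symmetric] by (rule arg_cong[where f = "(^) \<rho>"]) simp
  finally show ?thesis by simp
qed

lemma open_shell: "open (shell r)"
  unfolding shell_def by (intro open_Collect_conj open_Collect_less continuous_intros)

text \<open>Negative \<open>r\<close> is allowed, so that the unit ball is covered as \<open>shell (-1)\<close>; this is the reason for
  the parameter \<open>(max r 0)\<^sup>2\<close>.\<close>

lemma integral_monomial_shell: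
  fixes r :: real
  assumes "r < 1"
  defines "q \<equiv> (max r 0)\<^sup>2"
  shows "(LINT z:shell r|lborel. cmod (z $ 1) ^ (2 * k))
    = pi\<^sup>2 * (1 - q ^ (k + 2)) / ((real k + 1) * (real k + 2))"
proof -
  let ?f = "\<lambda>z :: complex ^ 2. ennreal (cmod (z $ 1) ^ (2 * k))"
  let ?c = "pi\<^sup>2 / ((real k + 1) * (real k + 2))"
  have f: "?f \<in> borel_measurable borel"
    by (intro measurable_compose[OF _ measurable_ennreal] borel_measurable_continuous_onI continuous_intros)
  have om: "shell r \<in> sets borel"
    using open_shell by simp
  have q: "0 \<le> q" "q \<le> 1" using assms by (auto simp: q_def power_le_one)
  have pq: "(max r 0) ^ (2 * k + 4) = q ^ (k + 2)"
    unfolding q_def power_mult[symmetric] by (rule arg_cong[where f = "(^) (max r 0)"]) simp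
  \<comment> \<open>For negative \<open>r\<close> the closed ball is empty and \<open>q\<close> is
    0; the right side vanishes too because the exponent k + 2 is positive.\<close>
  have cb: "(\<integral>\<^sup>+z\<in>cball 0 r. ?f z \<partial>lborel) = ennreal (?c * q ^ (k + 2))"
  proof (cases "r \<ge> 0")
    case True
    then show ?thesis
      using nn_integral_monomial_ball[OF True, of "cball 0 r" k] pq by simp
  next
    case False
    then show ?thesis by (simp add: q_def)
  qed
  have "ennreal ?c = (\<integral>\<^sup>+z\<in>ball 0 1. ?f z \<partial>lborel)"
    using nn_integral_monomial_ball[of 1 "ball 0 1" k] by simp
  also have "\<dots> = (\<integral>\<^sup>+z. ?f z * indicator (shell r) z + ?f z * indicator (cball 0 r) z \<partial>lborel)"
    using assms by (intro nn_integral_cong) (auto simp: indicator_def shell_def)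
  also have "\<dots> = (\<integral>\<^sup>+z\<in>shell r. ?f z \<partial>lborel) + ennreal (?c * q ^ (k + 2))"
    using borel_measurable_times_ennreal[OF f borel_measurable_indicator] om
    by (subst nn_integral_add) (simp_all add: cb)
  finally have "(\<integral>\<^sup>+z\<in>shell r. ?f z \<partial>lborel) = ennreal ?c - ennreal (?c * q ^ (k + 2))"
    by (simp add: ennreal_add_diff_cancel_right)
  also have "\<dots> = ennreal (?c - ?c * q ^ (k + 2))"
    using q by (intro ennreal_minus) simp
  also have "?c - ?c * q ^ (k + 2) = pi\<^sup>2 * (1 - q ^ (k + 2)) / ((real k + 1) * (real k + 2))"
    by (simp add: right_diff_distrib diff_divide_distrib del: power_Suc add_2_eq_Suc')
  finally have nn: "(\<integral>\<^sup>+z\<in>shell r. ?f z \<partial>lborel) = ennreal (pi\<^sup>2 * (1 - q ^ (k + 2)) / ((real k + 1) * (real k + 2)))" .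
  show ?thesis
    unfolding set_lebesgue_integral_def
  proof (rule integral_eq_nn_integral[THEN trans])
    have "(\<integral>\<^sup>+z. ennreal (indicator (shell r) z *\<^sub>R cmod (z $ 1) ^ (2 * k)) \<partial>lborel) = (\<integral>\<^sup>+z\<in>shell r. ?f z \<partial>lborel)"
      by (intro nn_integral_cong) (auto simp: indicator_def)
    then show "enn2real (\<integral>\<^sup>+z. ennreal (indicator (shell r) z *\<^sub>R cmod (z $ 1) ^ (2 * k)) \<partial>lborel)
        = pi\<^sup>2 * (1 - q ^ (k + 2)) / ((real k + 1) * (real k + 2))"
      unfolding nn using q by (simp add: power_le_one del: power_Suc add_2_eq_Suc')
    have "(\<lambda>z :: complex ^ 2. cmod (z $ 1) ^ (2 * k)) \<in> borel_measurable borel"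
      by (intro borel_measurable_continuous_onI continuous_intros)
    then show "(\<lambda>z. indicator (shell r) z *\<^sub>R cmod (z $ 1) ^ (2 * k)) \<in> borel_measurable lborel"
      using om by (intro borel_measurable_scaleR borel_measurable_indicator) auto
  qed auto
qed

section \<open>Circle means and Hartogs extension\<close>

text \<open>Written as an average over rotations of the base point, not as a contour integral, to
  match \<open>integral_rotation_average\<close>. At \<open>z = 0\<close> it is
  \<open>h 0\<close>.\<close>

definition circle_mean :: "(complex \<Rightarrow> complex) \<Rightarrow> complex \<Rightarrow> complex" where
  "circle_mean h z = (LINT t:{0..1}|lborel. h (cis (2 * pi * t) * z))"

lemma circle_mean_eq_integral:
  assumes "continuous_on {0..1} (\<lambda>t. h (cis (2 * pi * t) * z))"
  shows "circle_mean h z = integral {0..1} (\<lambda>t. h (cis (2 * pi * t) * z))"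
  unfolding circle_mean_def
  by (rule set_borel_integral_eq_integral(2)[OF borel_integrable_atLeastAtMost'[OF assms]])

lemma has_vector_derivative_cis_mult:
  "((\<lambda>t. cis (c * t)) has_vector_derivative (of_real c * \<i> * cis (c * t))) (at t within T)"
proof -
  have "((\<lambda>z. exp (of_real c * \<i> * z)) has_field_derivative
      exp (of_real c * \<i> * of_real t) * (of_real c * \<i>)) (at (of_real t))"
    by (auto intro!: derivative_eq_intros)
  then show ?thesis
    using has_vector_derivative_real_field[of "\<lambda>z. exp (of_real c * \<i> * z)"]
    by (simp add: cis_conv_exp mult_ac)
qed

lemma set_lebesgue_integral_cis:
  "(LINT t:{0..1}|lborel. cis (2 * pi * (of_int m * t))) = (if m = 0 then 1 else 0)"
proof (cases "m = 0")
  case False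
  have "((\<lambda>t. cis (2 * pi * (of_int m * t))) has_integral
      cis (2 * pi * (of_int m * 1)) / (2 * pi * of_int m * \<i>) - cis (2 * pi * (of_int m * 0)) / (2 * pi * of_int m * \<i>)) {0..1}"
  proof (rule fundamental_theorem_of_calculus)
    fix t :: real
    have "((\<lambda>t. cis (2 * pi * of_int m * t) / (2 * pi * of_int m * \<i>)) has_vector_derivative
        of_real (2 * pi * of_int m) * \<i> * cis (2 * pi * of_int m * t) / (2 * pi * of_int m * \<i>)) (at t within {0..1})"
      by (rule has_vector_derivative_divide[OF has_vector_derivative_cis_mult])
    then show "((\<lambda>t. cis (2 * pi * (of_int m * t)) / (2 * pi * of_int m * \<i>)) has_vector_derivative
        cis (2 * pi * (of_int m * t))) (at t within {0..1})"
      using False by (simp add: mult.assoc)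
  qed simp
  moreover have "cis (2 * pi * of_int m) = 1"
    by (metis cis_multiple_2pi mult.commute Ints_of_int mult.assoc)
  ultimately have "integral {0..1} (\<lambda>t. cis (2 * pi * (of_int m * t))) = 0"
    by (simp add: integral_unique)
  moreover have "continuous_on {0..1} (\<lambda>t. cis (2 * pi * (of_int m * t)))"
    by (intro continuous_intros)
  from set_borel_integral_eq_integral(2)[OF borel_integrable_atLeastAtMost'[OF this]]
  have "(LINT t:{0..1}|lborel. cis (2 * pi * (of_int m * t))) = integral {0..1} (\<lambda>t. cis (2 * pi * (of_int m * t)))" .
  ultimately show ?thesis
    using False by (simp only: if_False)
qed (simp add: set_lebesgue_integral_def)

text \<open>On the circle the Taylor term of degree n times \<open>cnj \<zeta> ^ k\<close> has
  frequency n - k, so only n = k survives: the conjugate power extracts one Taylor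
  coefficient.\<close>

lemma circle_mean_times_power_cnj:
  assumes g: "g holomorphic_on ball 0 R" and z: "cmod z < R"
  shows "circle_mean (\<lambda>\<zeta>. g \<zeta> * cnj \<zeta> ^ k) z = (deriv ^^ k) g 0 / fact k * of_real (cmod z ^ (2 * k))"
proof -
  define a where "a n = (deriv ^^ n) g 0 / fact n" for n
  let ?e = "\<lambda>n t. cis (2 * pi * (of_int (int n - int k) * t))"
  have g_sums: "(\<lambda>n. a n * \<zeta> ^ n) sums g \<zeta>" if "cmod \<zeta> < R" for \<zeta>
    using holomorphic_power_series[OF g, of \<zeta>] that by (simp add: a_def)
  have sa: "summable (\<lambda>n. norm (a n * z ^ n))"
  proof -
    \<comment> \<open>A radius strictly between |z| and \<open>R\<close>: convergence there gives
      absolute convergence at \<open>z\<close>, which justifies exchanging sum and integral.\<close>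
    define \<rho> where "\<rho> = (cmod z + R) / 2"
    have \<rho>: "cmod z < \<rho>" "\<rho> < R" using z by (auto simp: \<rho>_def)
    then have "0 \<le> \<rho>" using norm_ge_zero[of z] by linarith
    then have "summable (\<lambda>n. a n * of_real \<rho> ^ n)"
      using g_sums[of "of_real \<rho>"] \<rho> by (auto simp: sums_iff)
    then show ?thesis
      using \<rho> \<open>0 \<le> \<rho>\<close> by (intro powser_insidea) auto
  qed
  have "(\<lambda>n. LINT t|lborel. indicator {0..1} t *\<^sub>R (a n * z ^ n * cnj z ^ k * ?e n t))
      sums (LINT t|lborel. (\<Sum>n. indicator {0..1} t *\<^sub>R (a n * z ^ n * cnj z ^ k * ?e n t)))"
  proof (rule sums_integral)
    have int: "set_integrable lborel {0..1::real} (\<lambda>t. a n * z ^ n * cnj z ^ k * ?e n t)" for n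
      by (intro borel_integrable_atLeastAtMost' continuous_intros)
    then show "integrable lborel (\<lambda>t. indicator {0..1::real} t *\<^sub>R (a n * z ^ n * cnj z ^ k * ?e n t))" for n
      by (simp add: set_integrable_def)
    have n: "norm (indicator {0..1::real} t *\<^sub>R (a n * z ^ n * cnj z ^ k * ?e n t))
        = norm (a n * z ^ n) * cmod z ^ k * indicator {0..1} t" for n t
      by (simp add: norm_mult norm_power indicator_def)
    show "AE t in lborel. summable (\<lambda>n. norm (indicator {0..1::real} t *\<^sub>R (a n * z ^ n * cnj z ^ k * ?e n t)))"
      unfolding n by (intro AE_I2 summable_mult2 sa)
    show "summable (\<lambda>n. LINT t|lborel. norm (indicator {0..1::real} t *\<^sub>R (a n * z ^ n * cnj z ^ k * ?e n t)))"
      unfolding n using summable_mult2[OF sa, of "cmod z ^ k"] by simp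
  qed
  moreover have "(LINT t|lborel. indicator {0..1} t *\<^sub>R (a n * z ^ n * cnj z ^ k * ?e n t))
      = (if n = k then a k * of_real (cmod z ^ (2 * k)) else 0)" for n
  proof -
    have "(LINT t:{0..1}|lborel. a n * z ^ n * cnj z ^ k * ?e n t)
        = a n * z ^ n * cnj z ^ k * (LINT t:{0..1}|lborel. ?e n t)"
      by (rule set_integral_mult_right)
    also have "\<dots> = a n * z ^ n * cnj z ^ k * (if int n - int k = 0 then 1 else 0)"
      by (simp only: set_lebesgue_integral_cis)
    also have "\<dots> = (if n = k then a k * (z ^ k * cnj z ^ k) else 0)"
      by simp
    also have "z ^ k * cnj z ^ k = of_real (cmod z ^ (2 * k))"
      by (simp only: power_mult of_real_power[of "(cmod z)\<^sup>2" k] complex_norm_square power_mult_distrib)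
    finally show ?thesis by (simp only: set_lebesgue_integral_def)
  qed
  moreover have "(\<Sum>n. indicator {0..1} t *\<^sub>R (a n * z ^ n * cnj z ^ k * ?e n t))
      = indicator {0..1} t *\<^sub>R (g (cis (2 * pi * t) * z) * cnj (cis (2 * pi * t) * z) ^ k)" for t :: real
  proof -
    have "(\<lambda>n. a n * (cis (2 * pi * t) * z) ^ n * cnj (cis (2 * pi * t) * z) ^ k)
        sums (g (cis (2 * pi * t) * z) * cnj (cis (2 * pi * t) * z) ^ k)"
      by (intro sums_mult2 g_sums) (simp add: norm_mult z)
    moreover have "a n * (cis (2 * pi * t) * z) ^ n * cnj (cis (2 * pi * t) * z) ^ k = a n * z ^ n * cnj z ^ k * ?e n t" for n
    proof -
      have "cis (2 * pi * t) ^ n * cnj (cis (2 * pi * t)) ^ k = ?e n t"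
        unfolding cis_cnj Complex.DeMoivre cis_mult by (rule arg_cong[where f = cis]) (simp add: algebra_simps)
      then show ?thesis by (simp add: power_mult_distrib mult_ac)
    qed
    ultimately have "(\<lambda>n. a n * z ^ n * cnj z ^ k * ?e n t)
        sums (g (cis (2 * pi * t) * z) * cnj (cis (2 * pi * t) * z) ^ k)"
      by (simp only:)
    then show ?thesis
      by (intro sums_unique[symmetric] sums_scaleR_right)
  qed
  ultimately have "(\<lambda>n. if n = k then a k * of_real (cmod z ^ (2 * k)) else 0)
      sums circle_mean (\<lambda>\<zeta>. g \<zeta> * cnj \<zeta> ^ k) z"
    by (simp add: circle_mean_def set_lebesgue_integral_def)
  moreover have "(\<lambda>n. if n = k then a k * of_real (cmod z ^ (2 * k)) else 0) sums (a k * of_real (cmod z ^ (2 * k)))"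
    using sums_single[of k "\<lambda>n. a k * of_real (cmod z ^ (2 * k))"] by simp
  ultimately show ?thesis
    using sums_unique2 unfolding a_def by blast
qed

lemma circle_mean_disc:
  assumes "g holomorphic_on ball 0 R" "cmod z < R"
  shows "circle_mean g z = g 0"
  using circle_mean_times_power_cnj[OF assms, of 0] by simp

text \<open>The mean is the contour integral of h(\<zeta>)/\<zeta> over the circle through
  \<open>z\<close>, divided by 2 pi i, hence invariant under homotopies in the annulus. The
  assumption \<open>0 \<le> \<rho>\<close> keeps the pole at 0 outside.\<close>

lemma circle_mean_annulus:
  assumes h: "h holomorphic_on {\<zeta>. \<rho> < cmod \<zeta> \<and> cmod \<zeta> < \<rho>'}" and \<rho>: "0 \<le> \<rho>"
    and z: "\<rho> < cmod z" "cmod z < \<rho>'" and w: "\<rho> < cmod w" "cmod w < \<rho>'"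
  shows "circle_mean h z = circle_mean h w"
proof -
  define S where "S = {\<zeta>. \<rho> < cmod \<zeta> \<and> cmod \<zeta> < \<rho>'}"
  define \<gamma> where "\<gamma> = (\<lambda>v t. cis (2 * pi * t) * v)"
  have hS: "h holomorphic_on S" using h unfolding S_def .
  have openS: "open S"
    unfolding S_def by (intro open_Collect_conj open_Collect_less continuous_intros)
  have S0: "\<zeta> \<noteq> 0" if "\<zeta> \<in> S" for \<zeta> using that \<rho> by (auto simp: S_def)
  have \<gamma>S: "\<gamma> v t \<in> S" if "v \<in> S" for v t
    using that by (simp add: S_def \<gamma>_def norm_mult)
  have d\<gamma>: "(\<gamma> v has_vector_derivative (2 * pi * \<i> * \<gamma> v t)) (at t within T)" for v t T
    using has_vector_derivative_mult_left[OF has_vector_derivative_cis_mult[of "2 * pi" t T], of v]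
    by (simp add: \<gamma>_def mult_ac)
  have vp: "valid_path (\<gamma> v)" for v
    unfolding valid_path_def
  proof (rule C1_differentiable_imp_piecewise)
    have "continuous_on {0..1} (\<lambda>t. 2 * pi * \<i> * \<gamma> v t)"
      unfolding \<gamma>_def by (intro continuous_intros)
    then show "\<gamma> v C1_differentiable_on {0..1}"
      unfolding C1_differentiable_on_def
      by (intro exI[of _ "\<lambda>t. 2 * pi * \<i> * \<gamma> v t"] conjI ballI d\<gamma>)
  qed
  have cm: "circle_mean h v = contour_integral (\<gamma> v) (\<lambda>\<zeta>. h \<zeta> / \<zeta>) / (2 * pi * \<i>)" if v: "v \<in> S" for v
  proof -
    have "continuous_on {0..1} (\<gamma> v)" unfolding \<gamma>_def by (intro continuous_intros)
    then have "continuous_on {0..1} (\<lambda>t. h (\<gamma> v t))"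
      by (rule continuous_on_compose2[OF holomorphic_on_imp_continuous_on[OF hS]]) (use \<gamma>S v in auto)
    then have "circle_mean h v = integral {0..1} (\<lambda>t. h (\<gamma> v t))"
      unfolding \<gamma>_def by (rule circle_mean_eq_integral)
    also have "\<dots> = integral {0..1} (\<lambda>t. (h (\<gamma> v t) / \<gamma> v t * vector_derivative (\<gamma> v) (at t)) / (2 * pi * \<i>))"
      using S0[OF \<gamma>S[OF v]] by (intro integral_cong) (simp add: vector_derivative_at[OF d\<gamma>])
    also have "\<dots> = integral {0..1} (\<lambda>t. h (\<gamma> v t) / \<gamma> v t * vector_derivative (\<gamma> v) (at t)) / (2 * pi * \<i>)"
      by (rule integral_divide)
    finally show ?thesis by (simp only: contour_integral_integral)
  qed
  have zw: "z \<in> S" "w \<in> S" using z w by (auto simp: S_def)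
  have "path_connected S"
  proof -
    show ?thesis using path_connected_annulus(1)[of \<rho> "0 :: complex" \<rho>']
      by (simp add: S_def)
  qed
  then obtain c where c: "path c" "path_image c \<subseteq> S" "pathstart c = z" "pathfinish c = w"
    using zw unfolding path_connected_def by blast
  \<comment> \<open>At stage \<open>s\<close> the loop is the full circle based at
    \<open>c s\<close>, with \<open>c\<close> a path from \<open>z\<close> to \<open>w\<close>. This
    also accounts for different arguments of \<open>z\<close> and \<open>w\<close>.\<close>
  have "homotopic_loops S (\<gamma> z) (\<gamma> w)"
    unfolding homotopic_loops
  proof (rule exI[of _ "\<lambda>(s, t). \<gamma> (c s) t"], intro conjI ballI)
    let ?h = "\<lambda>(s, t). \<gamma> (c s) t"
    have "continuous_on ({0..1} \<times> {0..1}) (\<lambda>p :: real \<times> real. c (fst p))"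
      by (rule continuous_on_compose2[OF c(1)[unfolded path_def] continuous_on_fst[OF continuous_on_id]]) auto
    moreover have "continuous_on ({0..1} \<times> {0..1}) (\<lambda>p :: real \<times> real. cis (2 * pi * snd p))"
      by (intro continuous_intros)
    ultimately have "continuous_on ({0..1} \<times> {0..1}) (\<lambda>p. cis (2 * pi * snd p) * c (fst p))"
      by (rule continuous_on_mult[rotated])
    then show "continuous_on ({0..1} \<times> {0..1}) ?h"
      by (simp add: \<gamma>_def case_prod_beta')
    show "?h \<in> {0..1} \<times> {0..1} \<rightarrow> S"
      using c(2) \<gamma>S by (auto simp: path_image_def)
  qed (use c in \<open>auto simp: pathstart_def pathfinish_def \<gamma>_def\<close>)
  moreover have "(\<lambda>\<zeta>. h \<zeta> / \<zeta>) holomorphic_on S"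
    using hS S0 by (intro holomorphic_intros) auto
  ultimately have "contour_integral (\<gamma> z) (\<lambda>\<zeta>. h \<zeta> / \<zeta>) = contour_integral (\<gamma> w) (\<lambda>\<zeta>. h \<zeta> / \<zeta>)"
    using openS vp by (intro Cauchy_theorem_homotopic_loops)
  then show ?thesis using cm zw by simp
qed

text \<open>Morera's theorem; the integral over \<open>{0..1}\<close> is read as a contour integral along
  \<open>linepath 0 1\<close> so that the two integrations can be exchanged.\<close>

lemma holomorphic_parametric_integral:
  fixes \<phi> :: "complex \<Rightarrow> real \<Rightarrow> complex"
  assumes U: "open U" and cont: "continuous_on (U \<times> {0..1}) (\<lambda>(a, t). \<phi> a t)"
    and hol: "\<And>t. t \<in> {0..1} \<Longrightarrow> (\<lambda>a. \<phi> a t) holomorphic_on U"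
  shows "(\<lambda>a. integral {0..1} (\<phi> a)) holomorphic_on U"
proof -
  let ?\<psi> = "\<lambda>a \<zeta>. \<phi> a (Re \<zeta>)"
  let ?l = "linepath 0 (1::complex)"
  have eq: "integral {0..1} (\<phi> a) = contour_integral ?l (?\<psi> a)" for a
    unfolding contour_integral_integral
    by (intro integral_cong) (simp add: linepath_def)
  have cseg: "x \<in> {0..1}" if "\<zeta> \<in> closed_segment 0 (1::complex)" "x = Re \<zeta>" for \<zeta> x
    using that by (auto simp: closed_segment_def)
  have swap: "contour_integral (linepath a b) (\<lambda>w. contour_integral ?l (?\<psi> w))
      = contour_integral ?l (\<lambda>\<zeta>. contour_integral (linepath a b) (\<lambda>w. ?\<psi> w \<zeta>))"
    if "closed_segment a b \<subseteq> U" for a b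
  proof (rule contour_integral_swap)
    have "continuous_on (closed_segment a b \<times> closed_segment 0 1) (\<lambda>p. case (fst p, Re (snd p)) of (a, t) \<Rightarrow> \<phi> a t)"
      by (rule continuous_on_compose2[OF cont]) (use that cseg in \<open>auto intro!: continuous_intros\<close>)
    then show "continuous_on (path_image (linepath a b) \<times> path_image ?l) (\<lambda>(w, \<zeta>). ?\<psi> w \<zeta>)"
      by (simp add: case_prod_beta')
  qed auto
  have "(\<lambda>a. integral {0..1} (\<phi> a)) analytic_on U"
  proof (rule Morera_triangle[OF _ U], unfold cbox_interval[symmetric], rule integral_continuous_on_param)
    show "continuous_on (U \<times> cbox 0 1) (\<lambda>(x, t). \<phi> x t)" using cont by (simp add: cbox_interval)
  next
    fix a b c :: complex
    show "convex hull {a, b, c} \<subseteq> U \<longrightarrow>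
        contour_integral (linepath a b) (\<lambda>a. integral (cbox 0 1) (\<phi> a)) +
        contour_integral (linepath b c) (\<lambda>a. integral (cbox 0 1) (\<phi> a)) +
        contour_integral (linepath c a) (\<lambda>a. integral (cbox 0 1) (\<phi> a)) = 0"
    proof
      assume hull: "convex hull {a, b, c} \<subseteq> U"
      have seg: "closed_segment a b \<subseteq> U" "closed_segment b c \<subseteq> U" "closed_segment c a \<subseteq> U"
        using hull segments_subset_convex_hull[of a b c]
          segments_subset_convex_hull[of b c a] segments_subset_convex_hull[of c a b] by auto
      \<comment> \<open>Continuity in the outer variable allows the three contour integrals to be
        merged under one integral sign, where the sum vanishes pointwise.\<close>
      have cci: "(\<lambda>\<zeta>. contour_integral (linepath x y) (\<lambda>w. ?\<psi> w \<zeta>)) contour_integrable_on ?l"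
        if "closed_segment x y \<subseteq> U" for x y
      proof -
        have lp: "(1 - s) *\<^sub>R x + s *\<^sub>R y \<in> U" if "0 \<le> s" "s \<le> 1" for s
          using linepath_in_path[of s x y] that \<open>closed_segment x y \<subseteq> U\<close> by (auto simp: linepath_def)
        have "continuous_on (closed_segment 0 1 \<times> cbox 0 1)
            (\<lambda>(\<zeta>, s). (case (linepath x y s, Re \<zeta>) of (a, t) \<Rightarrow> \<phi> a t) * (y - x))"
          unfolding case_prod_beta
          by (intro continuous_intros continuous_on_compose2[OF cont[unfolded case_prod_beta]])
            (use lp cseg in \<open>auto intro!: continuous_intros simp: linepath_def cbox_interval\<close>)
        then have "continuous_on (closed_segment 0 1)
            (\<lambda>\<zeta>. integral (cbox 0 1) (\<lambda>s. \<phi> (linepath x y s) (Re \<zeta>) * (y - x)))"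
          by (intro integral_continuous_on_param) simp
        then have "continuous_on (closed_segment 0 1) (\<lambda>\<zeta>. contour_integral (linepath x y) (\<lambda>w. ?\<psi> w \<zeta>))"
          by (simp add: contour_integral_integral cbox_interval)
        then show ?thesis by (intro contour_integrable_continuous_linepath)
      qed
      have "contour_integral (linepath a b) (\<lambda>a. integral (cbox 0 1) (\<phi> a)) +
          contour_integral (linepath b c) (\<lambda>a. integral (cbox 0 1) (\<phi> a)) +
          contour_integral (linepath c a) (\<lambda>a. integral (cbox 0 1) (\<phi> a))
        = contour_integral ?l (\<lambda>\<zeta>. contour_integral (linepath a b) (\<lambda>w. ?\<psi> w \<zeta>)
          + contour_integral (linepath b c) (\<lambda>w. ?\<psi> w \<zeta>) + contour_integral (linepath c a) (\<lambda>w. ?\<psi> w \<zeta>))"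
        unfolding cbox_interval eq using seg swap cci
        by (simp add: contour_integral_add contour_integrable_add)
      also have "\<dots> = contour_integral ?l (\<lambda>\<zeta>. 0)"
      proof (rule contour_integral_eq)
        fix \<zeta> assume "\<zeta> \<in> path_image ?l"
        then have "(\<lambda>w. ?\<psi> w \<zeta>) holomorphic_on convex hull {a, b, c}"
          using hol cseg by (intro holomorphic_on_subset[OF _ hull]) auto
        then have "((\<lambda>w. ?\<psi> w \<zeta>) has_contour_integral 0) (linepath a b +++ linepath b c +++ linepath c a)"
          by (rule Cauchy_theorem_triangle)
        then show "contour_integral (linepath a b) (\<lambda>w. ?\<psi> w \<zeta>)
          + contour_integral (linepath b c) (\<lambda>w. ?\<psi> w \<zeta>) + contour_integral (linepath c a) (\<lambda>w. ?\<psi> w \<zeta>) = 0"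
          by (rule has_chain_integral_chain_integral3)
      qed
      finally show "contour_integral (linepath a b) (\<lambda>a. integral (cbox 0 1) (\<phi> a)) +
          contour_integral (linepath b c) (\<lambda>a. integral (cbox 0 1) (\<phi> a)) +
          contour_integral (linepath c a) (\<lambda>a. integral (cbox 0 1) (\<phi> a)) = 0" by simp
    qed
  qed
  then show ?thesis by (rule analytic_imp_holomorphic)
qed

section \<open>Slices of functions on a shell and their Hartogs extension\<close>

lemma vec2_in_shell:
  "vec2 (a, b) \<in> shell r \<longleftrightarrow> r < sqrt ((cmod a)\<^sup>2 + (cmod b)\<^sup>2) \<and> sqrt ((cmod a)\<^sup>2 + (cmod b)\<^sup>2) < 1"
  by (simp add: shell_def norm_vec2)

lemma holomorphic_sv_imp_continuous_on:
  "holomorphic_sv f D \<Longrightarrow> continuous_on D f"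
  unfolding holomorphic_sv_def
  by (meson continuous_at_imp_continuous_on has_derivative_continuous)

lemma bounded_linear_vector_smult: "bounded_linear (\<lambda>h :: complex. h *s (v :: complex ^ 'n))"
  by (rule linear_conv_bounded_linear[THEN iffD1], rule linearI)
    (simp_all add: vec_eq_iff algebra_simps)

lemma holomorphic_sv_line:
  assumes f: "holomorphic_sv f D"
  shows "(\<lambda>\<zeta>. f (p + \<zeta> *s v)) holomorphic_on {\<zeta>. p + \<zeta> *s v \<in> D}"
  unfolding holomorphic_on_def
proof
  fix \<zeta> assume "\<zeta> \<in> {\<zeta>. p + \<zeta> *s v \<in> D}"
  then obtain f' where f': "(f has_derivative f') (at (p + \<zeta> *s v))" and lin: "\<And>c u. f' (c *s u) = c * f' u"
    using f unfolding holomorphic_sv_def by blast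
  have "((\<lambda>\<zeta>. p + \<zeta> *s v) has_derivative (\<lambda>h. h *s v)) (at \<zeta>)"
    using has_derivative_add[OF has_derivative_const[of p] bounded_linear_imp_has_derivative[OF bounded_linear_vector_smult]]
    by simp
  from has_derivative_compose[OF this f']
  have "((\<lambda>\<zeta>. f (p + \<zeta> *s v)) has_derivative (*) (f' v)) (at \<zeta>)"
    by (simp add: lin mult.commute[of _ "f' v"])
  then show "(\<lambda>\<zeta>. f (p + \<zeta> *s v)) field_differentiable (at \<zeta> within {\<zeta>. p + \<zeta> *s v \<in> D})"
    unfolding field_differentiable_def has_field_derivative_def
    using has_derivative_at_withinI by blast
qed

lemma holomorphic_sv_slice:
  assumes f: "holomorphic_sv f D"
  shows "(\<lambda>b. f (vec2 (a, b))) holomorphic_on {b. vec2 (a, b) \<in> D}"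
    and "(\<lambda>a. f (vec2 (a, b))) holomorphic_on {a. vec2 (a, b) \<in> D}"
proof -
  have "vec2 (a, 0) + b *s vec2 (0, 1) = vec2 (a, b)" "vec2 (0, b) + a *s vec2 (1, 0) = vec2 (a, b)" for a b
    by (simp_all add: vec_eq_iff forall_2)
  then show "(\<lambda>b. f (vec2 (a, b))) holomorphic_on {b. vec2 (a, b) \<in> D}"
    "(\<lambda>a. f (vec2 (a, b))) holomorphic_on {a. vec2 (a, b) \<in> D}"
    using holomorphic_sv_line[OF f, of "vec2 (a, 0)" "vec2 (0, 1)"]
      holomorphic_sv_line[OF f, of "vec2 (0, b)" "vec2 (1, 0)"] by simp_all
qed

text \<open>Hartogs: averaging \<open>f\<close> over circles in \<open>z $ 2\<close> gives a function of \<open>z $ 1\<close> alone that is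
  holomorphic in the whole unit disc. For \<open>\<bar>z $ 1\<bar> \<le> r\<close> the radius \<open>3/4\<close> is always available, as
  \<open>r < 1/2\<close>.\<close>

lemma circle_mean_extension:
  assumes r: "r < 1/2" and f: "holomorphic_sv f (shell r)"
  obtains g where "g holomorphic_on ball 0 1"
    and "\<And>z. z \<in> shell r \<Longrightarrow> circle_mean (\<lambda>b. f (vec2 (z $ 1, b))) (z $ 2) = g (z $ 1)"
proof -
  define F where "F a b = f (vec2 (a, b))" for a b
  \<comment> \<open>For |a| > r the slice in the second coordinate is a full disc and the mean is
    the value at its centre; otherwise the slice is an annulus, and its means do not depend on the
    radius.\<close>
  define g where "g a = (if r < cmod a then F a 0 else circle_mean (F a) (3/4))" for a
  have large: "circle_mean (F a) b = F a 0" if a: "r < cmod a" and ab: "vec2 (a, b) \<in> shell r" for a b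
  proof (rule circle_mean_disc)
    have "r < sqrt ((cmod a)\<^sup>2 + (cmod b)\<^sup>2)" for b
      using a by (rule less_le_trans) (rule real_le_rsqrt, simp)
    moreover have "(cmod a)\<^sup>2 + (cmod b)\<^sup>2 < 1" if "cmod b < sqrt (1 - (cmod a)\<^sup>2)" for b
    proof -
      have "sqrt ((cmod b)\<^sup>2) < sqrt (1 - (cmod a)\<^sup>2)" using that by simp
      then show ?thesis unfolding real_sqrt_less_iff by simp
    qed
    ultimately have "ball 0 (sqrt (1 - (cmod a)\<^sup>2)) \<subseteq> {b. vec2 (a, b) \<in> shell r}"
      by (auto simp: vec2_in_shell)
    then show "F a holomorphic_on ball 0 (sqrt (1 - (cmod a)\<^sup>2))"
      unfolding F_def[abs_def] using holomorphic_sv_slice(1)[OF f] holomorphic_on_subset by blast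
    have "(cmod a)\<^sup>2 + (cmod b)\<^sup>2 < 1" using ab by (simp add: vec2_in_shell)
    then show "cmod b < sqrt (1 - (cmod a)\<^sup>2)" by (intro real_less_rsqrt) simp
  qed
  have small: "circle_mean (F a) b = circle_mean (F a) (3/4)"
    if a: "\<not> r < cmod a" and ab: "vec2 (a, b) \<in> shell r" for a b
  proof (rule circle_mean_annulus)
    have r0: "0 \<le> r" using a norm_ge_zero[of a] by linarith
    have r2: "r\<^sup>2 < (1/2)\<^sup>2" "(cmod a)\<^sup>2 \<le> r\<^sup>2"
      using r r0 a by (auto intro!: power_strict_mono power_mono)
    let ?\<rho> = "sqrt (r\<^sup>2 - (cmod a)\<^sup>2)" and ?\<rho>' = "sqrt (1 - (cmod a)\<^sup>2)"
    have iff: "vec2 (a, b) \<in> shell r \<longleftrightarrow> ?\<rho> < cmod b \<and> cmod b < ?\<rho>'" for b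
    proof -
      have "?\<rho> < sqrt ((cmod b)\<^sup>2) \<longleftrightarrow> sqrt (r\<^sup>2) < sqrt ((cmod a)\<^sup>2 + (cmod b)\<^sup>2)"
        unfolding real_sqrt_less_iff by auto
      moreover have "sqrt ((cmod b)\<^sup>2) < ?\<rho>' \<longleftrightarrow> (cmod a)\<^sup>2 + (cmod b)\<^sup>2 < 1"
        unfolding real_sqrt_less_iff by auto
      ultimately show ?thesis using r0 by (simp add: vec2_in_shell)
    qed
    show "F a holomorphic_on {b. ?\<rho> < cmod b \<and> cmod b < ?\<rho>'}"
      unfolding F_def[abs_def] using holomorphic_sv_slice(1)[OF f, of a] by (simp only: iff)
    show "0 \<le> ?\<rho>" using r2 by simp
    show "?\<rho> < cmod b" "cmod b < ?\<rho>'" using ab iff by auto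
    have "r\<^sup>2 - (cmod a)\<^sup>2 < (3/4)\<^sup>2"
      using r2(1) zero_le_power2[of "cmod a"] unfolding power2_eq_square[of "1/2"] power2_eq_square[of "3/4"]
      by linarith
    then have "?\<rho> < 3/4"
      using r2 by (intro real_less_lsqrt) auto
    then show "?\<rho> < cmod (3/4)" by simp
    have "3/4 < ?\<rho>'"
      using r2 by (intro real_less_rsqrt) (auto simp: power2_eq_square)
    then show "cmod (3/4) < ?\<rho>'" by simp
  qed
  have mean: "circle_mean (\<lambda>b. f (vec2 (z $ 1, b))) (z $ 2) = g (z $ 1)" if "z \<in> shell r" for z
    using that large[of "z $ 1" "z $ 2"] small[of "z $ 1" "z $ 2"] unfolding g_def F_def[abs_def] by simp
  \<comment> \<open>The radius 3/4 is admissible for all |a| < 1/2, beyond |a| <= r, because 1/4 +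
    9/16 < 1 and r < 3/4. The overlap glues the two formulas for \<open>g\<close>.\<close>
  have in_shell: "vec2 (a, 3 * cis t / 4) \<in> shell r" if "cmod a < 1/2" for a t
  proof -
    have "(cmod a)\<^sup>2 < (1/2)\<^sup>2" using that by (intro power_strict_mono) auto
    then have "(cmod a)\<^sup>2 + (3/4)\<^sup>2 < 1" by (simp add: power2_eq_square)
    moreover have "r < sqrt ((cmod a)\<^sup>2 + (3/4)\<^sup>2)"
    proof -
      have "3/4 \<le> sqrt ((cmod a)\<^sup>2 + (3/4)\<^sup>2)" by (rule real_le_rsqrt) simp
      then show ?thesis using r by linarith
    qed
    ultimately show ?thesis by (simp add: vec2_in_shell norm_mult)
  qed
  have "g holomorphic_on ball 0 (1/2)"
  proof -
    let ?\<phi> = "\<lambda>a t. f (vec2 (a, 3 * cis (2 * pi * t) / 4))"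
    have vc: "continuous_on UNIV vec2"
      unfolding vec2_def
    proof (rule continuous_on_vec_lambda)
      show "continuous_on UNIV (\<lambda>p. if i = 1 then fst p else snd p)" for i :: 2
        by (cases "i = 1") (auto intro!: continuous_intros)
    qed
    have "continuous_on (ball 0 (1/2) \<times> {0..1}) (\<lambda>p. vec2 (fst p, 3 * cis (2 * pi * snd p) / 4))"
      by (intro continuous_on_compose2[OF vc] continuous_intros) auto
    then have c: "continuous_on (ball 0 (1/2) \<times> {0..1}) (\<lambda>p. ?\<phi> (fst p) (snd p))"
      by (rule continuous_on_compose2[OF holomorphic_sv_imp_continuous_on[OF f]]) (auto simp: in_shell)
    have "(\<lambda>a. integral {0..1} (?\<phi> a)) holomorphic_on ball 0 (1/2)"
    proof (rule holomorphic_parametric_integral)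
      show "continuous_on (ball 0 (1/2) \<times> {0..1}) (\<lambda>(a, t). ?\<phi> a t)"
        using c by (simp add: case_prod_beta')
      show "(\<lambda>a. ?\<phi> a t) holomorphic_on ball 0 (1/2)" for t
        by (rule holomorphic_on_subset[OF holomorphic_sv_slice(2)[OF f]]) (auto simp: in_shell)
    qed simp
    moreover have "integral {0..1} (?\<phi> a) = g a" if a: "a \<in> ball 0 (1/2)" for a
    proof -
      have "continuous_on {0..1} (\<lambda>t. ?\<phi> (fst (a, t)) (snd (a, t)))"
        by (rule continuous_on_compose2[OF c]) (use a in \<open>auto intro!: continuous_intros\<close>)
      then have "circle_mean (F a) (3/4) = integral {0..1} (?\<phi> a)"
        by (subst circle_mean_eq_integral) (simp_all add: F_def mult.commute)
      moreover have "vec2 (a, 3/4) \<in> shell r" using in_shell[of a 0] a by simp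
      ultimately show ?thesis using large[of a "3/4"] by (auto simp: g_def)
    qed
    ultimately show ?thesis by (rule holomorphic_transform)
  qed
  moreover have "g holomorphic_on {a. r < cmod a \<and> cmod a < 1}"
  proof -
    have "(\<lambda>a. F a 0) holomorphic_on {a. r < cmod a \<and> cmod a < 1}"
      unfolding F_def using holomorphic_sv_slice(2)[OF f, of 0] by (simp add: vec2_in_shell)
    then show ?thesis by (rule holomorphic_transform) (simp add: g_def)
  qed
  ultimately have "g holomorphic_on ball 0 (1/2) \<union> {a. r < cmod a \<and> cmod a < 1}"
    by (intro holomorphic_on_Un open_Collect_conj open_Collect_less continuous_intros) auto
  then have "g holomorphic_on ball 0 1"
    by (rule holomorphic_on_subset) (use r in auto)
  then show ?thesis using mean that by blast
qed

section \<open>The Bergman kernel of a shell\<close>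

definition shell_series :: "real \<Rightarrow> complex \<Rightarrow> complex" where
  "shell_series q x = (\<Sum>k. of_real (shell_coeff q k) * x ^ k) / of_real (pi\<^sup>2)"

definition herm2 :: "complex ^ 2 \<Rightarrow> complex ^ 2 \<Rightarrow> complex" where
  "herm2 z w = z $ 1 * cnj (w $ 1) + z $ 2 * cnj (w $ 2)"

lemma norm_herm2_le: "cmod (herm2 z w) \<le> norm z * norm w"
proof -
  have "cmod (herm2 z w) \<le> (\<Sum>i\<in>UNIV. \<bar>cmod (z $ i)\<bar> * \<bar>cmod (w $ i)\<bar>)"
    unfolding herm2_def by (simp add: sum_2) (metis norm_mult norm_triangle_ineq complex_mod_cnj)
  also have "\<dots> \<le> norm z * norm w"
    unfolding norm_vec_def by (rule L2_set_mult_ineq)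
  finally show ?thesis .
qed

lemma herm2_self: "herm2 z z = of_real ((norm z)\<^sup>2)"
proof -
  have "(norm z)\<^sup>2 = (cmod (z $ 1))\<^sup>2 + (cmod (z $ 2))\<^sup>2"
    by (simp add: norm_vec_def L2_set_def sum_2)
  then show ?thesis by (simp add: herm2_def complex_norm_square del: of_real_power)
qed

lemma shell_series_holomorphic:
  assumes "0 \<le> q" "q < 1" "cmod x < 1"
  shows "\<exists>d. (shell_series q has_field_derivative d) (at x)"
proof -
  have "((\<lambda>x. \<Sum>k. of_real (shell_coeff q k) * x ^ k) has_field_derivative
      (\<Sum>k. diffs (\<lambda>k. of_real (shell_coeff q k)) k * x ^ k)) (at x)"
    by (rule termdiffs_strong'[where K = 1])
      (use summable_norm_cancel[OF summable_shell_coeff[OF assms(1,2)]] assms(3) in auto)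
  then show ?thesis
    unfolding shell_series_def[abs_def] using DERIV_cdivide by blast
qed

lemma holomorphic_sv_shell_series:
  assumes q: "0 \<le> q" "q < 1" and D: "\<And>z. z \<in> D \<Longrightarrow> cmod (herm2 z w) < 1"
  shows "holomorphic_sv (\<lambda>z. shell_series q (herm2 z w)) D"
  unfolding holomorphic_sv_def
proof
  fix z assume "z \<in> D"
  then obtain d where "(shell_series q has_field_derivative d) (at (herm2 z w))"
    using shell_series_holomorphic[OF q D] by blast
  then have d: "(shell_series q has_derivative (*) d) (at (herm2 z w))"
    by (simp add: has_field_derivative_def)
  have "linear (\<lambda>z. herm2 z w)"
    by (rule linearI) (simp_all add: herm2_def algebra_simps)
  then have "((\<lambda>z. herm2 z w) has_derivative (\<lambda>z. herm2 z w)) (at z)"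
    by (simp add: linear_conv_bounded_linear bounded_linear_imp_has_derivative)
  from has_derivative_compose[OF this d]
  show "\<exists>f'. ((\<lambda>z. shell_series q (herm2 z w)) has_derivative f') (at z) \<and> (\<forall>c v. f' (c *s v) = c * f' v)"
    by (intro exI[of _ "\<lambda>v. d * herm2 v w"]) (simp add: herm2_def algebra_simps)
qed

lemma norm_shell_series_le:
  assumes q: "0 \<le> q" "q < 1" and x: "cmod x \<le> s" "s < 1"
  shows "cmod (shell_series q x) \<le> (\<Sum>k. shell_coeff q k * s ^ k) / pi\<^sup>2"
proof -
  have s: "0 \<le> s" using x norm_ge_zero[of x] by linarith
  have sm: "summable (\<lambda>k. shell_coeff q k * s ^ k)"
    using summable_norm_cancel[OF summable_shell_coeff[OF q, of s]] s x by simp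
  have n: "norm (of_real (shell_coeff q k) * x ^ k) \<le> shell_coeff q k * s ^ k" for k
    using shell_coeff_pos[OF q, of k] x
    by (simp add: norm_mult norm_power mult_left_mono power_mono)
  have "cmod (\<Sum>k. of_real (shell_coeff q k) * x ^ k) \<le> (\<Sum>k. shell_coeff q k * s ^ k)"
    by (rule norm_suminf_le[OF n sm])
  then show ?thesis
    by (simp add: shell_series_def norm_divide divide_right_mono norm_power)
qed

lemma emeasure_shell_finite: "emeasure lborel (shell r) < \<infinity>"
proof -
  have "bounded (shell r)"
    by (rule bounded_subset[OF bounded_ball[of 0 1]]) (auto simp: shell_def)
  then show ?thesis by (rule emeasure_bounded_finite)
qed

lemma set_integrable_shell_bounded:
  fixes f :: "complex ^ 2 \<Rightarrow> 'b::{banach,second_countable_topology}"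
  assumes c: "continuous_on (shell r) f" and B: "\<And>z. z \<in> shell r \<Longrightarrow> norm (f z) \<le> B"
  shows "set_integrable lborel (shell r) f"
  unfolding set_integrable_def
proof (rule integrableI_bounded_set[where A = "shell r" and B = B])
  have o: "shell r \<in> sets borel" using open_shell by simp
  then show "shell r \<in> sets lborel" by simp
  show "(\<lambda>z. indicator (shell r) z *\<^sub>R f z) \<in> borel_measurable lborel"
    using borel_measurable_continuous_on_indicator[OF o c] by simp
qed (use emeasure_shell_finite B in auto)

text \<open>x <= 1 + x^2 and finite volume put L^2 inside L^1. Integrability of \<open>f\<close>
  itself is what dominates the kernel series when it is integrated term by term.\<close>

lemma L2h_shell_set_integrable:
  assumes f: "f \<in> L2h (shell r)"
  shows "set_integrable lborel (shell r) f"
  unfolding set_integrable_def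
proof (rule Bochner_Integration.integrable_bound)
  have "set_integrable lborel (shell r) (\<lambda>z. 1 + (cmod (f z))\<^sup>2)"
    using f set_integrable_shell_bounded[of r "\<lambda>_. 1 :: real" 1]
    by (intro set_integral_add) (auto simp: L2h_def)
  then show "integrable lborel (\<lambda>z. indicator (shell r) z *\<^sub>R (1 + (cmod (f z))\<^sup>2))"
    by (simp add: set_integrable_def)
  have o: "shell r \<in> sets borel" using open_shell by simp
  show "(\<lambda>z. indicator (shell r) z *\<^sub>R f z) \<in> borel_measurable lborel"
    using f borel_measurable_continuous_on_indicator[OF o, of f]
    by (simp add: L2h_def holomorphic_sv_imp_continuous_on)
  have "x \<le> 1 + x\<^sup>2" for x :: real
    using zero_le_power2[of "x - 1/2"] by (simp add: power2_eq_square algebra_simps)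
  then have "norm (f z) \<le> norm (1 + (cmod (f z))\<^sup>2)" for z
    by (metis abs_ge_self order_trans real_norm_def)
  then show "AE z in lborel. norm (indicator (shell r) z *\<^sub>R f z)
      \<le> norm (indicator (shell r) z *\<^sub>R (1 + (cmod (f z))\<^sup>2))"
    by (intro AE_I2) (simp add: indicator_def)
qed

text \<open>For fixed \<open>w\<close> the argument stays in the closed disc of radius |w| < 1, so
  the kernel is bounded, and the shell has finite volume.\<close>

lemma shell_series_in_L2h:
  assumes q: "0 \<le> q" "q < 1" and w: "w \<in> shell r"
  shows "(\<lambda>z. shell_series q (herm2 z w)) \<in> L2h (shell r)"
proof -
  have w1: "norm w < 1" using w by (simp add: shell_def)
  have n: "cmod (herm2 z w) \<le> norm w" if "z \<in> shell r" for z
  proof -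
    have "norm z * norm w \<le> 1 * norm w"
      using that by (intro mult_right_mono) (auto simp: shell_def)
    then show ?thesis using norm_herm2_le[of z w] by linarith
  qed
  have h: "holomorphic_sv (\<lambda>z. shell_series q (herm2 z w)) (shell r)"
    using n w1 by (intro holomorphic_sv_shell_series q) force
  have "set_integrable lborel (shell r) (\<lambda>z. (cmod (shell_series q (herm2 z w)))\<^sup>2)"
  proof (rule set_integrable_shell_bounded)
    show "continuous_on (shell r) (\<lambda>z. (cmod (shell_series q (herm2 z w)))\<^sup>2)"
      by (intro continuous_intros holomorphic_sv_imp_continuous_on h)
    fix z assume "z \<in> shell r"
    then show "norm ((cmod (shell_series q (herm2 z w)))\<^sup>2) \<le> ((\<Sum>k. shell_coeff q k * norm w ^ k) / pi\<^sup>2)\<^sup>2"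
      using norm_shell_series_le[OF q n w1] by (simp add: power_mono)
  qed
  then show ?thesis using h by (simp add: L2h_def)
qed

lemma measurable_vec2_rotation:
  "(\<lambda>(t, z :: complex ^ 2). vec2 (z $ 1, cis (2 * pi * t) * z $ 2)) \<in> borel_measurable borel"
  "(\<lambda>(t, z :: complex ^ 2). vec2 (cis (2 * pi * t) * z $ 1, z $ 2)) \<in> borel_measurable borel"
proof -
  have "continuous_on UNIV (\<lambda>(t, z :: complex ^ 2). vec2 (z $ 1, cis (2 * pi * t) * z $ 2))"
    unfolding vec2_def case_prod_beta
  proof (rule continuous_on_vec_lambda)
    show "continuous_on UNIV (\<lambda>p :: real \<times> (complex ^ 2). if i = 1 then fst (snd p $ 1, cis (2 * pi * fst p) * snd p $ 2)
        else snd (snd p $ 1, cis (2 * pi * fst p) * snd p $ 2))" for i :: 2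
      by (cases "i = 1") (auto intro!: continuous_intros)
  qed
  then show "(\<lambda>(t, z :: complex ^ 2). vec2 (z $ 1, cis (2 * pi * t) * z $ 2)) \<in> borel_measurable borel"
    by (rule borel_measurable_continuous_onI)
  have "continuous_on UNIV (\<lambda>(t, z :: complex ^ 2). vec2 (cis (2 * pi * t) * z $ 1, z $ 2))"
    unfolding vec2_def case_prod_beta
  proof (rule continuous_on_vec_lambda)
    show "continuous_on UNIV (\<lambda>p :: real \<times> (complex ^ 2). if i = 1 then fst (cis (2 * pi * fst p) * snd p $ 1, snd p $ 2)
        else snd (cis (2 * pi * fst p) * snd p $ 1, snd p $ 2))" for i :: 2
      by (cases "i = 1") (auto intro!: continuous_intros)
  qed
  then show "(\<lambda>(t, z :: complex ^ 2). vec2 (cis (2 * pi * t) * z $ 1, z $ 2)) \<in> borel_measurable borel"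
    by (rule borel_measurable_continuous_onI)
qed

lemma rotation_in_shell:
  "cmod \<alpha> = 1 \<Longrightarrow> vec2 (\<alpha> * z $ 1, z $ 2) \<in> shell r \<longleftrightarrow> z \<in> shell r"
  "cmod \<alpha> = 1 \<Longrightarrow> vec2 (z $ 1, \<alpha> * z $ 2) \<in> shell r \<longleftrightarrow> z \<in> shell r"
  using vec2_in_shell[of "z $ 1" "z $ 2" r] by (simp_all add: vec2_in_shell norm_mult)

text \<open>Two averagings leave the integral unchanged. Rotating \<open>z $ 2\<close> replaces
  \<open>f\<close> by \<open>g\<close>; rotating \<open>z $ 1\<close> then keeps only the k-th
  Taylor term of \<open>g\<close>, against the weight |z_1|^(2k) whose integral is known.\<close>

lemma shell_moment:
  assumes r: "r < 1/2" and f: "f \<in> L2h (shell r)" and g: "g holomorphic_on ball 0 1"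
    and mean: "\<And>z. z \<in> shell r \<Longrightarrow> circle_mean (\<lambda>b. f (vec2 (z $ 1, b))) (z $ 2) = g (z $ 1)"
  shows "set_integrable lborel (shell r) (\<lambda>z. f z * cnj (z $ 1) ^ k)"
    and "(LINT z:shell r|lborel. f z * cnj (z $ 1) ^ k)
      = (deriv ^^ k) g 0 / fact k * of_real (pi\<^sup>2 / shell_coeff ((max r 0)\<^sup>2) k)"
proof -
  let ?D = "shell r"
  have o: "?D \<in> sets borel" using open_shell by simp
  have fh: "holomorphic_sv f ?D" using f by (simp add: L2h_def)
  have z1: "cmod (z $ 1) < 1" if "z \<in> ?D" for z
    using that Finite_Cartesian_Product.norm_nth_le[of z 1] by (simp add: shell_def)
  show int: "set_integrable lborel ?D (\<lambda>z. f z * cnj (z $ 1) ^ k)"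
  proof (rule set_integrable_bound[OF L2h_shell_set_integrable[OF f]])
    have "continuous_on ?D (\<lambda>z. f z * cnj (z $ 1) ^ k)"
      by (intro continuous_intros holomorphic_sv_imp_continuous_on fh)
    then show "set_borel_measurable lborel ?D (\<lambda>z. f z * cnj (z $ 1) ^ k)"
      unfolding set_borel_measurable_def using borel_measurable_continuous_on_indicator[OF o] by simp
    have "norm (f z * cnj (z $ 1) ^ k) \<le> norm (f z)" if "z \<in> ?D" for z
    proof -
      have "cmod (z $ 1) ^ k \<le> 1" using z1[OF that] by (intro power_le_one) auto
      then show ?thesis by (simp add: norm_mult norm_power mult_left_le)
    qed
    then show "AE z\<in>?D in lborel. norm (f z * cnj (z $ 1) ^ k) \<le> norm (f z)" by simp
  qed
  let ?H1 = "\<lambda>z. indicator ?D z *\<^sub>R (f z * cnj (z $ 1) ^ k)"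
  let ?H2 = "\<lambda>z. indicator ?D z *\<^sub>R (g (z $ 1) * cnj (z $ 1) ^ k)"
  let ?H3 = "\<lambda>z. indicator ?D z *\<^sub>R ((deriv ^^ k) g 0 / fact k * of_real (cmod (z $ 1) ^ (2 * k)))"
  note R1 = integral_rotation_average[OF _ lborel_preserving_vec2_rotation(2)[OF norm_cis] measurable_vec2_rotation(1)]
  note R2 = integral_rotation_average[OF _ lborel_preserving_vec2_rotation(1)[OF norm_cis] measurable_vec2_rotation(2)]
  have H12: "(LINT t:{0..1}|lborel. ?H1 (vec2 (z $ 1, cis (2 * pi * t) * z $ 2))) = ?H2 z" for z
  proof (cases "z \<in> ?D")
    case True
    have "(LINT t:{0..1}|lborel. f (vec2 (z $ 1, cis (2 * pi * t) * z $ 2)) * cnj (z $ 1) ^ k)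
        = circle_mean (\<lambda>b. f (vec2 (z $ 1, b))) (z $ 2) * cnj (z $ 1) ^ k"
      unfolding circle_mean_def by (rule set_integral_mult_left)
    then show ?thesis using True mean[OF True] by (simp add: rotation_in_shell)
  qed (simp add: rotation_in_shell set_lebesgue_integral_def)
  have H23: "(LINT t:{0..1}|lborel. ?H2 (vec2 (cis (2 * pi * t) * z $ 1, z $ 2))) = ?H3 z" for z
  proof (cases "z \<in> ?D")
    case True
    then show ?thesis
      using circle_mean_times_power_cnj[OF g z1[OF True], of k]
      by (simp add: rotation_in_shell circle_mean_def)
  qed (simp add: rotation_in_shell set_lebesgue_integral_def)
  have i1: "integrable lborel ?H1" using int by (simp add: set_integrable_def)
  \<comment> \<open>\<open>g\<close> may be unbounded near the unit circle, so integrability of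
    \<open>?H2\<close> is inherited from the averaging of \<open>?H1\<close>.\<close>
  have i2: "integrable lborel ?H2" "(LINT z|lborel. ?H2 z) = (LINT z|lborel. ?H1 z)"
    using R1[OF i1] by (simp_all only: H12)
  have "(LINT z|lborel. ?H3 z) = (LINT z|lborel. ?H2 z)"
    using R2(2)[OF i2(1)] by (simp only: H23)
  then have "(LINT z:?D|lborel. f z * cnj (z $ 1) ^ k)
      = (LINT z:?D|lborel. (deriv ^^ k) g 0 / fact k * of_real (cmod (z $ 1) ^ (2 * k)))"
    using i2(2) by (simp only: set_lebesgue_integral_def)
  also have "\<dots> = (deriv ^^ k) g 0 / fact k * (LINT z:?D|lborel. of_real (cmod (z $ 1) ^ (2 * k)))"
    by (rule set_integral_mult_right)
  also have "(LINT z:?D|lborel. complex_of_real (cmod (z $ 1) ^ (2 * k)))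
      = of_real (LINT z:?D|lborel. cmod (z $ 1) ^ (2 * k))"
    by (rule set_integral_complex_of_real)
  also have "(LINT z:?D|lborel. cmod (z $ 1) ^ (2 * k)) = pi\<^sup>2 / shell_coeff ((max r 0)\<^sup>2) k"
    using r by (subst integral_monomial_shell) (simp_all add: shell_coeff_def)
  finally show "(LINT z:?D|lborel. f z * cnj (z $ 1) ^ k)
      = (deriv ^^ k) g 0 / fact k * of_real (pi\<^sup>2 / shell_coeff ((max r 0)\<^sup>2) k)" .
qed

text \<open>On this axis \<open>herm2 z w\<close> involves only \<open>z $ 1\<close>, so the kernel
  series meets \<open>f\<close> only through the moments of \<open>shell_moment\<close>. The
  coefficients cancel the norms, and what remains is the Taylor series of \<open>g\<close> at
  \<open>w $ 1\<close>.\<close>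

lemma shell_reproducing_axis:
  assumes r: "r < 1/2" and f: "f \<in> L2h (shell r)" and w: "w \<in> shell r" "w $ 2 = 0"
  shows "f w = (LINT z:shell r|lborel. f z * cnj (shell_series ((max r 0)\<^sup>2) (herm2 z w)))"
proof -
  let ?D = "shell r"
  define q where "q = (max r 0)\<^sup>2"
  define c where "c k = shell_coeff q k" for k
  have q: "0 \<le> q" "q < 1" using r by (auto simp: q_def power_less_one_iff)
  have cpos: "0 < c k" for k unfolding c_def by (rule shell_coeff_pos[OF q])
  have fh: "holomorphic_sv f ?D" using f by (simp add: L2h_def)
  obtain g where g: "g holomorphic_on ball 0 1"
    and mean: "\<And>z. z \<in> ?D \<Longrightarrow> circle_mean (\<lambda>b. f (vec2 (z $ 1, b))) (z $ 2) = g (z $ 1)"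
    using circle_mean_extension[OF r fh] by blast
  have w_eq: "vec2 (w $ 1, 0) = w" using w(2) vec2_eta[of w] by simp
  have wn: "cmod (w $ 1) < 1" using w(1) Finite_Cartesian_Product.norm_nth_le[of w 1] by (simp add: shell_def)
  \<comment> \<open>The circle in the second coordinate degenerates to the point 0, so the mean is
    the value of \<open>f\<close> itself.\<close>
  have gw: "g (w $ 1) = f w"
    using mean[OF w(1)] w(2) w_eq by (simp add: circle_mean_def set_lebesgue_integral_def)
  let ?T = "\<lambda>k z. (indicator ?D z *\<^sub>R (f z * cnj (z $ 1) ^ k)) * (of_real (c k / pi\<^sup>2) * (w $ 1) ^ k)"
  note mom = shell_moment[OF r f g mean]
  have z1: "cmod (z $ 1) < 1" if "z \<in> ?D" for z
    using that Finite_Cartesian_Product.norm_nth_le[of z 1] by (simp add: shell_def)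
  have cw: "summable (\<lambda>k. norm (of_real (c k / pi\<^sup>2) * (w $ 1) ^ k))"
    using summable_divide[OF summable_shell_coeff[OF q wn], of "pi\<^sup>2"]
    by (simp add: c_def norm_mult norm_divide norm_power)
  have nT: "norm (?T k z) \<le> norm (indicator ?D z *\<^sub>R f z) * norm (of_real (c k / pi\<^sup>2) * (w $ 1) ^ k)" for k z
  proof (cases "z \<in> ?D")
    case True
    have "cmod (z $ 1) ^ k \<le> 1" using z1[OF True] by (intro power_le_one) auto
    then have "norm (f z * cnj (z $ 1) ^ k) \<le> norm (f z)"
      by (simp add: norm_mult norm_power mult_left_le)
    then show ?thesis using True unfolding norm_mult[of "indicator ?D z *\<^sub>R (f z * cnj (z $ 1) ^ k)"]
      by (intro mult_right_mono) auto
  qed simp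
  have fi: "integrable lborel (\<lambda>z. indicator ?D z *\<^sub>R f z)"
    using L2h_shell_set_integrable[OF f] by (simp add: set_integrable_def)
  have Ti: "integrable lborel (?T k)" for k
    using mom(1)[of k] unfolding set_integrable_def by (rule integrable_mult_left)
  have "(\<lambda>k. LINT z|lborel. ?T k z) sums (LINT z|lborel. (\<Sum>k. ?T k z))"
  proof (rule sums_integral)
    show "AE z in lborel. summable (\<lambda>k. norm (?T k z))"
    proof (intro AE_I2)
      fix z show "summable (\<lambda>k. norm (?T k z))"
        by (rule summable_comparison_test'[OF summable_mult[OF cw]]) (use nT in simp)
    qed
    show "summable (\<lambda>k. LINT z|lborel. norm (?T k z))"
    proof (rule summable_comparison_test'[OF summable_mult[OF cw]])
      fix k
      have "(LINT z|lborel. norm (?T k z))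
          \<le> (LINT z|lborel. norm (indicator ?D z *\<^sub>R f z) * norm (of_real (c k / pi\<^sup>2) * (w $ 1) ^ k))"
        by (intro integral_mono integrable_norm Ti integrable_mult_left fi nT)
      also have "\<dots> = (LINT z|lborel. norm (indicator ?D z *\<^sub>R f z)) * norm (of_real (c k / pi\<^sup>2) * (w $ 1) ^ k)"
        by (rule integral_mult_left_zero)
      finally show "norm (LINT z|lborel. norm (?T k z))
          \<le> (LINT z|lborel. norm (indicator ?D z *\<^sub>R f z)) * norm (of_real (c k / pi\<^sup>2) * (w $ 1) ^ k)"
        by (simp add: integral_nonneg_AE)
    qed
  qed (rule Ti)
  moreover have "(LINT z|lborel. ?T k z) = (deriv ^^ k) g 0 / fact k * (w $ 1) ^ k" for k
  proof -
    have "(LINT z|lborel. ?T k z) = (LINT z:?D|lborel. f z * cnj (z $ 1) ^ k) * (of_real (c k / pi\<^sup>2) * (w $ 1) ^ k)"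
      unfolding set_lebesgue_integral_def by (rule integral_mult_left_zero)
    also have "(LINT z:?D|lborel. f z * cnj (z $ 1) ^ k) = (deriv ^^ k) g 0 / fact k * of_real (pi\<^sup>2 / c k)"
      unfolding c_def q_def by (rule mom(2))
    also have "\<dots> * (of_real (c k / pi\<^sup>2) * (w $ 1) ^ k)
        = (deriv ^^ k) g 0 / fact k * (of_real (pi\<^sup>2 / c k) * of_real (c k / pi\<^sup>2)) * (w $ 1) ^ k"
      by (simp only: mult_ac)
    also have "of_real (pi\<^sup>2 / c k) * of_real (c k / pi\<^sup>2) = (1 :: complex)"
      using cpos[of k] unfolding of_real_mult[symmetric] by simp
    finally show ?thesis by simp
  qed
  moreover have "(\<Sum>k. ?T k z) = indicator ?D z *\<^sub>R (f z * cnj (shell_series q (herm2 z w)))" for z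
  proof (cases "z \<in> ?D")
    case True
    have hw: "herm2 z w = z $ 1 * cnj (w $ 1)" using w(2) by (simp add: herm2_def)
    have "cmod (z $ 1) * cmod (w $ 1) < 1 * 1"
      using z1[OF True] wn by (intro mult_strict_mono') auto
    then have n: "norm (herm2 z w) < 1" by (simp add: hw norm_mult)
    have "(\<lambda>k. of_real (c k) * herm2 z w ^ k) sums (of_real (pi\<^sup>2) * shell_series q (herm2 z w))"
      using summable_sums[OF summable_norm_cancel[OF summable_shell_coeff[OF q n]]]
      by (simp add: shell_series_def c_def)
    from sums_mult2[OF sums_cnj[THEN iffD2, OF this], of "f z / of_real (pi\<^sup>2)"]
    have "(\<lambda>k. ?T k z) sums (f z * cnj (shell_series q (herm2 z w)))"
      using True by (simp add: hw power_mult_distrib mult_ac)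
    then show ?thesis using True by (simp add: sums_iff)
  qed simp
  ultimately have "(\<lambda>k. (deriv ^^ k) g 0 / fact k * (w $ 1) ^ k)
      sums (LINT z:?D|lborel. f z * cnj (shell_series q (herm2 z w)))"
    by (simp add: set_lebesgue_integral_def)
  moreover have "(\<lambda>k. (deriv ^^ k) g 0 / fact k * (w $ 1) ^ k) sums f w"
    using holomorphic_power_series[OF g, of "w $ 1"] wn gw by simp
  ultimately show ?thesis
    unfolding q_def by (rule sums_unique2[symmetric])
qed

lemma linear_continuous_on_vec:
  fixes U :: "complex ^ 2 \<Rightarrow> complex ^ 2"
  shows "linear U \<Longrightarrow> continuous_on S U"
  by (simp add: linear_continuous_on linear_conv_bounded_linear)

text \<open>A unitary change of variables carries \<open>w\<close> to the first coordinate axis.\<close>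

lemma shell_reproducing:
  assumes r: "r < 1/2" and f: "f \<in> L2h (shell r)" and w: "w \<in> shell r"
  shows "f w = (LINT z:shell r|lborel. f z * cnj (shell_series ((max r 0)\<^sup>2) (herm2 z w)))"
proof (cases "w $ 2 = 0")
  case True
  then show ?thesis using shell_reproducing_axis[OF r f w] by blast
next
  case False
  let ?D = "shell r" and ?G = "shell_series ((max r 0)\<^sup>2)"
  define s where "s = norm w"
  have s0: "s > 0" using False by (auto simp: s_def)
  \<comment> \<open>The first column of \<open>U\<close> is w/|w|, so that \<open>U\<close> maps
    (|w|, 0) to \<open>w\<close>. Its lower left entry \<beta> is nonzero because
    \<open>w $ 2\<close> is, as \<open>lborel_preserving_SL2\<close> requires; hence the case
    split.\<close>
  define \<alpha> \<beta> where "\<alpha> = w $ 1 / of_real s" and "\<beta> = w $ 2 / of_real s"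
  define U where "U z = vec2 (\<alpha> * z $ 1 + (- cnj \<beta>) * z $ 2, \<beta> * z $ 1 + cnj \<alpha> * z $ 2)" for z :: "complex ^ 2"
  have ww: "w $ 1 * cnj (w $ 1) + w $ 2 * cnj (w $ 2) = of_real s * of_real s"
    using herm2_self[of w] by (simp add: herm2_def s_def power2_eq_square)
  have det: "\<alpha> * cnj \<alpha> + \<beta> * cnj \<beta> = 1"
    using ww s0 by (simp add: \<alpha>_def \<beta>_def field_simps)
  have \<alpha>w: "\<alpha> * cnj (w $ 1) + \<beta> * cnj (w $ 2) = of_real s"
    using ww s0 by (simp add: \<alpha>_def \<beta>_def field_simps)
  have \<beta>w: "cnj \<alpha> * cnj (w $ 2) = cnj \<beta> * cnj (w $ 1)"
    by (simp add: \<alpha>_def \<beta>_def)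
  have lin: "linear U"
    by (rule linearI) (simp_all add: U_def vec_eq_iff forall_2 algebra_simps)
  have smult: "U (c *s v) = c *s U v" for c v
    by (simp add: U_def vec_eq_iff forall_2 algebra_simps)
  have "herm2 (U z) (U z) = (\<alpha> * cnj \<alpha> + \<beta> * cnj \<beta>) * herm2 z z" for z
    by (simp add: herm2_def U_def algebra_simps)
  then have "(norm (U z))\<^sup>2 = (norm z)\<^sup>2" for z
    by (metis det herm2_self mult_1 of_real_eq_iff)
  then have normU: "norm (U z) = norm z" for z
    by (simp add: power2_eq_iff_nonneg)
  then have UD: "U z \<in> ?D \<longleftrightarrow> z \<in> ?D" for z
    by (simp add: shell_def)
  have Um: "U \<in> borel_measurable borel"
    by (intro borel_measurable_continuous_onI linear_continuous_on_vec lin)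
  have pres: "lborel_preserving U"
  proof (rule lborel_preserving_of_vec2[OF _ Um])
    have "lborel_preserving (\<lambda>(x, y). (\<alpha> * x + (- cnj \<beta>) * y, \<beta> * x + cnj \<alpha> * y))"
      using det False s0 by (intro lborel_preserving_SL2) (auto simp: \<beta>_def mult.commute)
    from lborel_preserving_comp[OF this lborel_preserving_vec2]
    show "lborel_preserving (\<lambda>p. U (vec2 p))"
      by (simp add: U_def case_prod_beta')
  qed
  have change: "(LINT z|lborel. h (U z)) = (LINT z|lborel. h z)"
    if "h \<in> borel_measurable borel" for h :: "complex ^ 2 \<Rightarrow> complex"
    using pres that by (subst integral_distr[symmetric, where N = borel]) (auto simp: lborel_preserving_def)
  define e where "e = vec2 (of_real s, 0)"
  have Ue: "U e = w"
    using s0 by (simp add: U_def e_def \<alpha>_def \<beta>_def)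
  have e: "e \<in> ?D" "e $ 2 = 0"
    using UD[of e] w Ue by (simp_all add: e_def)
  \<comment> \<open>Unitarity moves \<open>U\<close> to the other argument as its adjoint, which
    takes \<open>w\<close> back to \<open>e\<close>.\<close>
  have he: "herm2 (U z) w = herm2 z e" for z
  proof -
    have "herm2 (U z) w = (\<alpha> * cnj (w $ 1) + \<beta> * cnj (w $ 2)) * z $ 1
        + (cnj \<alpha> * cnj (w $ 2) - cnj \<beta> * cnj (w $ 1)) * z $ 2"
      by (simp add: herm2_def U_def algebra_simps)
    then show ?thesis by (simp add: \<alpha>w \<beta>w herm2_def e_def)
  qed
  have fh: "holomorphic_sv f ?D" and fint: "set_integrable lborel ?D (\<lambda>z. (cmod (f z))\<^sup>2)"
    using f by (auto simp: L2h_def)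
  have fU: "(\<lambda>z. f (U z)) \<in> L2h ?D"
    unfolding L2h_def mem_Collect_eq
  proof
    show "holomorphic_sv (\<lambda>z. f (U z)) ?D"
      unfolding holomorphic_sv_def
    proof
      fix z assume "z \<in> ?D"
      then obtain f' where f': "(f has_derivative f') (at (U z))" and fl: "\<And>c v. f' (c *s v) = c * f' v"
        using fh UD unfolding holomorphic_sv_def by blast
      have "(U has_derivative U) (at z)"
        using lin by (simp add: linear_conv_bounded_linear bounded_linear_imp_has_derivative)
      from has_derivative_compose[OF this f']
      show "\<exists>f'. ((\<lambda>z. f (U z)) has_derivative f') (at z) \<and> (\<forall>c v. f' (c *s v) = c * f' v)"
        by (auto simp: smult fl)
    qed
    have "integrable lborel (\<lambda>z. indicator ?D (U z) *\<^sub>R (cmod (f (U z)))\<^sup>2)"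
      using fint pres unfolding set_integrable_def lborel_preserving_def
      by (subst integrable_distr_eq[symmetric, where N = borel and f = "\<lambda>z. indicator ?D z *\<^sub>R (cmod (f z))\<^sup>2"]) auto
    moreover have "indicator ?D (U z) = (indicator ?D z :: real)" for z
      by (simp add: indicator_def UD)
    ultimately show "set_integrable lborel ?D (\<lambda>z. (cmod (f (U z)))\<^sup>2)"
      by (simp add: set_integrable_def)
  qed
  have q: "0 \<le> (max r 0)\<^sup>2" "(max r 0)\<^sup>2 < 1" using r by (auto simp: power_less_one_iff)
  have "continuous_on ?D (\<lambda>z. f z * cnj (?G (herm2 z w)))"
    using shell_series_in_L2h[OF q w] fh
    by (intro continuous_intros holomorphic_sv_imp_continuous_on) (auto simp: L2h_def)
  moreover have "?D \<in> sets borel" using open_shell by simp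
  ultimately have meas: "(\<lambda>z. indicator ?D z *\<^sub>R (f z * cnj (?G (herm2 z w)))) \<in> borel_measurable borel"
    by (rule borel_measurable_continuous_on_indicator[rotated])
  have "f w = f (U e)" by (simp add: Ue)
  also have "\<dots> = (LINT z:?D|lborel. f (U z) * cnj (?G (herm2 z e)))"
    by (rule shell_reproducing_axis[OF r fU e])
  also have "\<dots> = (LINT z:?D|lborel. f z * cnj (?G (herm2 z w)))"
    using change[OF meas] by (simp add: set_lebesgue_integral_def he UD indicator_def)
  finally show ?thesis .
qed

section \<open>Closed forms of the kernel and of the two metrics\<close>

lemma bergman_kernel_shell:
  assumes r: "r < 1/2" and z: "z \<in> shell r" and w: "w \<in> shell r"
  shows "bergman_kernel (shell r) z w = shell_series ((max r 0)\<^sup>2) (herm2 z w)"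
proof -
  have q: "0 \<le> (max r 0)\<^sup>2" "(max r 0)\<^sup>2 < 1" using r by (auto simp: power_less_one_iff)
  have K: "reproducing_kernel (shell r) (\<lambda>z w. shell_series ((max r 0)\<^sup>2) (herm2 z w))"
    unfolding reproducing_kernel_def
    using shell_series_in_L2h[OF q] shell_reproducing[OF r] by blast
  \<comment> \<open>Existence makes the choice in \<open>bergman_kernel\<close> a genuine
    reproducing kernel; uniqueness then identifies its values on the shell.\<close>
  then have "reproducing_kernel (shell r) (bergman_kernel (shell r))"
    unfolding bergman_kernel_def by (rule someI[where P = "reproducing_kernel (shell r)"])
  from reproducing_kernel_unique[OF this K z w] show ?thesis .
qed

text \<open>\<open>P0\<close>, \<open>P1\<close>, \<open>P2\<close> are pi^2 Phi and its first two
  derivatives in t; the constant factor drops out of the logarithmic derivative. The expression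
  under the root is (log P0)' + t (log P0)''.\<close>

lemma bergman_metric_shell:
  fixes r :: real and p :: "complex ^ 2"
  assumes r: "r < 1/2" and p: "p \<in> shell r" "p \<noteq> 0"
  defines "d \<equiv> shell_defect ((max r 0)\<^sup>2)" and "t \<equiv> (norm p)\<^sup>2"
  defines "P0 \<equiv> 2 / (1 - t) ^ 3 + (\<Sum>k. d k * t ^ k)"
    and "P1 \<equiv> 6 / (1 - t) ^ 4 + (\<Sum>k. diffs d k * t ^ k)"
    and "P2 \<equiv> 24 / (1 - t) ^ 5 + (\<Sum>k. diffs (diffs d) k * t ^ k)"
  shows "bergman_metric (shell r) p (p /\<^sub>R norm p)
    = sqrt (P1 / P0 + t * ((P2 * P0 - P1 * P1) / (P0 * P0)))"
proof -
  define q where "q = (max r 0)\<^sup>2"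
  have q: "0 \<le> q" "q < 1" using r by (auto simp: q_def power_less_one_iff)
  have d: "d = shell_defect q" by (simp add: d_def q_def)
  define Q0 where "Q0 x = 2 / (1 - x) ^ 3 + (\<Sum>k. d k * x ^ k)" for x :: real
  define Q1 where "Q1 x = 6 / (1 - x) ^ 4 + (\<Sum>k. diffs d k * x ^ k)" for x :: real
  have s0: "summable (\<lambda>k. d k * x ^ k)" if "norm x < 1" for x :: real
    unfolding d using summable_shell_defect[OF q that] .
  have s1: "summable (\<lambda>k. diffs d k * x ^ k)" if "norm x < 1" for x :: real
    by (rule termdiff_converges[of x 1]) (use s0 that in auto)
  have D0: "((\<lambda>x. \<Sum>k. d k * x ^ k) has_real_derivative (\<Sum>k. diffs d k * x ^ k)) (at x)"
    if "norm x < 1" for x :: real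
    by (rule termdiffs_strong'[where K = 1]) (use s0 that in auto)
  have D1: "((\<lambda>x. \<Sum>k. diffs d k * x ^ k) has_real_derivative (\<Sum>k. diffs (diffs d) k * x ^ k)) (at x)"
    if "norm x < 1" for x :: real
    by (rule termdiffs_strong'[where K = 1]) (use s1 that in auto)
  have Q0': "(Q0 has_real_derivative Q1 x) (at x)" if "norm x < 1" for x
  proof -
    have "((\<lambda>x. 2 / (1 - x) ^ 3) has_real_derivative 6 / (1 - x) ^ 4) (at x)"
      using that by (auto intro!: derivative_eq_intros simp: divide_simps power_numeral_reduce) (simp add: algebra_simps)
    then show ?thesis unfolding Q0_def[abs_def] Q1_def by (rule DERIV_add[OF _ D0[OF that]])
  qed
  have t1: "norm ((norm z)\<^sup>2) < 1" if "z \<in> shell r" for z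
    using that by (simp add: shell_def power_less_one_iff)
  have Q1': "(Q1 has_real_derivative P2) (at t)"
  proof -
    have "((\<lambda>x. 6 / (1 - x) ^ 4) has_real_derivative 24 / (1 - t) ^ 5) (at t)"
      using t1[OF p(1)] by (auto intro!: derivative_eq_intros simp: t_def divide_simps power_numeral_reduce) (simp add: algebra_simps)
    then show ?thesis unfolding Q1_def[abs_def] P2_def
      using DERIV_add D1 t1[OF p(1)] unfolding t_def by blast
  qed
  have pos: "Q0 ((norm z)\<^sup>2) > 0" if "z \<in> shell r" for z
  proof -
    have "0 \<le> (\<Sum>k. d k * ((norm z)\<^sup>2) ^ k)"
      using shell_defect_nonneg[OF q] by (intro suminf_nonneg s0 t1 that) (simp add: d)
    moreover have "0 < 2 / (1 - (norm z)\<^sup>2) ^ 3"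
      using t1[OF that] by (intro divide_pos_pos zero_less_power) auto
    ultimately show ?thesis unfolding Q0_def by linarith
  qed
  have "bergman_metric (shell r) p (p /\<^sub>R norm p)
      = sqrt (Q1 ((norm p)\<^sup>2) / Q0 ((norm p)\<^sup>2) + (norm p)\<^sup>2 * ((P2 * P0 - P1 * P1) / (P0 * P0)))"
  proof (rule bergman_metric_radial[where u = "\<lambda>x. ln (Q0 x / pi\<^sup>2)" and ?u1.0 = "\<lambda>x. Q1 x / Q0 x"])
    show "ln (Re (bergman_kernel (shell r) z z)) = ln (Q0 ((norm z)\<^sup>2) / pi\<^sup>2)" if z: "z \<in> shell r" for z
    proof -
      have "(\<lambda>k. complex_of_real (shell_coeff q k * ((norm z)\<^sup>2) ^ k))
          sums of_real (\<Sum>k. shell_coeff q k * ((norm z)\<^sup>2) ^ k)"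
        using summable_norm_cancel[OF summable_shell_coeff[OF q t1[OF z]]]
        by (intro sums_of_real summable_sums) simp
      then have "(\<Sum>k. of_real (shell_coeff q k) * complex_of_real ((norm z)\<^sup>2) ^ k)
          = of_real (\<Sum>k. shell_coeff q k * ((norm z)\<^sup>2) ^ k)"
        by (simp add: sums_iff)
      also have "\<dots> = of_real (Q0 ((norm z)\<^sup>2))"
        by (simp only: shell_coeff_suminf[OF q t1[OF z]] Q0_def d)
      finally show ?thesis
        unfolding bergman_kernel_shell[OF r z z] herm2_self q_def[symmetric] shell_series_def
        by (simp add: Re_divide_of_real flip: of_real_power)
    qed
    show "((\<lambda>x. ln (Q0 x / pi\<^sup>2)) has_real_derivative Q1 ((norm z)\<^sup>2) / Q0 ((norm z)\<^sup>2)) (at ((norm z)\<^sup>2))"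
      if z: "z \<in> shell r" for z
      using Q0'[OF t1[OF z]] pos[OF z] by (auto intro!: derivative_eq_intros simp: field_simps)
    have "((\<lambda>x. Q1 x / Q0 x) has_real_derivative (P2 * Q0 t - Q1 t * Q1 t) / (Q0 t * Q0 t)) (at t)"
      using pos[OF p(1)] t1[OF p(1)] Q0' by (intro DERIV_divide Q1') (auto simp: t_def)
    then show "((\<lambda>x. Q1 x / Q0 x) has_real_derivative (P2 * P0 - P1 * P1) / (P0 * P0)) (at ((norm p)\<^sup>2))"
      by (simp only: t_def[symmetric] P0_def P1_def Q0_def Q1_def)
  qed (use p open_shell in auto)
  then show ?thesis
    by (simp only: t_def[symmetric] P0_def P1_def Q0_def Q1_def)
qed

text \<open>Here \<open>q = 0\<close> makes \<open>shell_defect\<close> vanish, so only powers of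
  1/(1-t) are left to simplify.\<close>

lemma bergman_metric_ball:
  fixes p :: "complex ^ 2"
  assumes p: "norm p < 1" "p \<noteq> 0"
  shows "bergman_metric (ball 0 1) p (p /\<^sub>R norm p) = sqrt (3 / (1 - (norm p)\<^sup>2)\<^sup>2)"
proof -
  have ball: "ball 0 1 = shell (- 1)"
    by (auto simp: shell_def intro: less_le_trans[of _ 0])
  define y where "y = 1 - (norm p)\<^sup>2"
  have y: "y > 0" "(norm p)\<^sup>2 = 1 - y" using p by (auto simp: y_def power_less_one_iff)
  have d: "shell_defect 0 = (\<lambda>_. 0)" by (simp add: shell_defect_def fun_eq_iff)
  have "bergman_metric (ball 0 1) p (p /\<^sub>R norm p)
    = sqrt ((6 / y ^ 4) / (2 / y ^ 3) + (1 - y) * ((24 / y ^ 5 * (2 / y ^ 3) - 6 / y ^ 4 * (6 / y ^ 4)) / (2 / y ^ 3 * (2 / y ^ 3))))"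
    unfolding ball using bergman_metric_shell[of "- 1" p] p
    by (simp add: d diffs_def y(2) flip: ball)
  also have "(6 / y ^ 4) / (2 / y ^ 3) = 3 / y"
    using y(1) by (simp add: field_simps power_numeral_reduce)
  also have "(24 / y ^ 5 * (2 / y ^ 3) - 6 / y ^ 4 * (6 / y ^ 4)) / (2 / y ^ 3 * (2 / y ^ 3)) = 3 / y\<^sup>2"
    using y(1) by (simp add: field_simps power_numeral_reduce)
  also have "3 / y + (1 - y) * (3 / y\<^sup>2) = 3 / y\<^sup>2"
    using y(1) by (simp add: field_simps power2_eq_square)
  finally show ?thesis by (simp add: y_def)
qed

theorem proposition3:
  shows "\<exists>r0::real. 0 < r0 \<and> r0 < 1 \<and>
    (\<forall>r. 0 < r \<and> r < r0 \<longrightarrow>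
      (\<exists>\<eta>>0. \<forall>z0\<in>shell r. r < norm z0 \<and> norm z0 < r + \<eta> \<longrightarrow>
        bergman_metric (shell r) z0 (z0 /\<^sub>R norm z0)
          < bergman_metric (ball (0 :: complex ^ 2) 1) z0 (z0 /\<^sub>R norm z0)))"
proof (rule exI[of _ "1/4"], intro conjI allI impI)
  \<comment> \<open>The bound 1/4 gives \<open>r\<^sup>2 < 1/16\<close>, the threshold on
    \<open>q\<close> in \<open>shell_defect_inequality\<close>, and lies below the 1/2 of the
    Hartogs extension.\<close>
  fix r :: real assume r: "0 < r \<and> r < 1/4"
  show "\<exists>\<eta>>0. \<forall>z0\<in>shell r. r < norm z0 \<and> norm z0 < r + \<eta> \<longrightarrow>
        bergman_metric (shell r) z0 (z0 /\<^sub>R norm z0)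
          < bergman_metric (ball (0 :: complex ^ 2) 1) z0 (z0 /\<^sub>R norm z0)"
  proof (rule exI[of _ "1/4 - r"], intro conjI ballI impI)
    \<comment> \<open>With this \<eta> the norm of \<open>z0\<close> stays below 1/4, which is the
      threshold t < 1/16; the region covered reaches a radius independent of
      \<open>r\<close>.\<close>
    show "1/4 - r > 0" using r by simp
    fix z0 :: "complex ^ 2"
    assume z0: "z0 \<in> shell r" "r < norm z0 \<and> norm z0 < r + (1/4 - r)"
    have n: "norm z0 < 1/4" "z0 \<noteq> 0" using z0 r by auto
    have sq: "x\<^sup>2 < 1/16" if "0 < x" "x < 1/4" for x :: real
      using power_strict_mono[OF that(2), of 2] that(1) by (simp add: power2_eq_square)
    have q: "0 < r\<^sup>2" "r\<^sup>2 < 1/16" and t: "0 < (norm z0)\<^sup>2" "(norm z0)\<^sup>2 < 1/16"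
      using sq r n by auto
    have m: "(max r 0)\<^sup>2 = r\<^sup>2" using r by simp
    have r2: "r < 1/2" using r by simp
    have t1: "(norm z0)\<^sup>2 < 1" using t by simp
    show "bergman_metric (shell r) z0 (z0 /\<^sub>R norm z0)
          < bergman_metric (ball (0 :: complex ^ 2) 1) z0 (z0 /\<^sub>R norm z0)"
      unfolding bergman_metric_shell[OF r2 z0(1) n(2)] m
      using log_derivative_comparison[OF t(1) t1 less_imp_le[OF shell_defect_inequality(2)[OF q t]]
          shell_defect_inequality(1)[OF q t]] n
      by (subst bergman_metric_ball) auto
  qed
qed auto

end
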